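(* Let $\mathscr G$ be an ample groupoid, $K$ a commutative ring with unit, $x\in\mathscr G^0$, and let $V$ be a simple $K\mathscr G$-module. Then the $KG_x$-module $\mathrm{Res}_x(V)$ is either zero or a simple $KG_x$-module.
   Context: A groupoid is a small category with all arrows invertible; objects are identified with units, $\mathscr G^0$ is the unit space, $d(g)=g^{-1}g$, $r(g)=gg^{-1}$, and $gh$ is defined iff $d(g)=r(h)$. "Compact" includes Hausdorff. An étale groupoid is a topological groupoid, locally compact (not necessarily Hausdorff), with $\mathscr G^0$ locally compact Hausdorff and $d\colon\mathscr G\to\mathscr G^0$ a local homeomorphism. A slice is an open $U\subseteq\mathscr G$ with $d|_U$, $r|_U$ injective. $\mathscr G$ is ample if it is étale and the set $\mathscr G^a$ of compact slices is a basis of its topology. $\chi_U$ is the characteristic function of $U$. Give $K$ the discrete topology. $K\mathscr G$ is the $K$-module of functions $\mathscr G\to K$ spanned by those $f$ for which there is an open Hausdorff subspace $V$ such that $f$ vanishes outside $V$ and $f|_V$ is continuous with compact support, with convolution product $f\ast g(x)=\sum_{y\in d^{-1}(d(x))}f(xy^{-1})g(y)$. All modules $M$ over a $K$-algebra $A$ are non-degenerate, i.e. $AM=M$ (this includes simple modules). $G_x=\{g\in\mathscr G\mid d(g)=x=r(g)\}$ is the isotropy group at $x$. For a $K\mathscr G$-module $V$, $\mathrm{Res}_x(V)=\bigcap_U\chi_UV$, over all compact open $U\subseteq\mathscr G^0$ with $x\in U$. It is a $KG_x$-module via $gw=\chi_Uw$ for $g\in G_x$, $w\in\mathrm{Res}_x(V)$,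 where $U\in\mathscr G^a$ is any compact slice containing $g$ (this is well defined, independent of $U$). *)

theory Defs
  imports "HOL-Analysis.Analysis" "HOL-Algebra.Group" "HOL-Library.Function_Algebras"
begin

section \<open>Ample groupoids\<close>

record 'g top_groupoid =
  top_of :: "'g topology"
  gcomp :: "'g \<Rightarrow> 'g \<Rightarrow> 'g"
  ginv :: "'g \<Rightarrow> 'g"

definition arrows :: "'g top_groupoid \<Rightarrow> 'g set" where
  "arrows \<G> = topspace (top_of \<G>)"

definition src :: "'g top_groupoid \<Rightarrow> 'g \<Rightarrow> 'g" where
  "src \<G> g = gcomp \<G> (ginv \<G> g) g"

definition rng :: "'g top_groupoid \<Rightarrow> 'g \<Rightarrow> 'g" where
  "rng \<G> g = gcomp \<G> g (ginv \<G> g)"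

definition units :: "'g top_groupoid \<Rightarrow> 'g set" where
  "units \<G> = src \<G> ` arrows \<G>"

definition composable :: "'g top_groupoid \<Rightarrow> ('g \<times> 'g) set" where
  "composable \<G> = {(g, h). g \<in> arrows \<G> \<and> h \<in> arrows \<G> \<and> src \<G> g = rng \<G> h}"

text \<open>
  The axioms say that \<^term>\<open>arrows \<G>\<close> is a category in which every object is identified with
  its identity arrow and every arrow is invertible. The value of \<^term>\<open>gcomp \<G> g h\<close> outside
  \<^term>\<open>composable \<G>\<close> is irrelevant.
\<close>

locale groupoid =
  fixes \<G> :: "'g top_groupoid"
  assumes inv_closed: "g \<in> arrows \<G> \<Longrightarrow> ginv \<G> g \<in> arrows \<G>"
    and src_inv: "g \<in> arrows \<G> \<Longrightarrow> src \<G> (ginv \<G> g) = rng \<G> g"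
    and rng_inv: "g \<in> arrows \<G> \<Longrightarrow> rng \<G> (ginv \<G> g) = src \<G> g"
    and comp_closed: "(g, h) \<in> composable \<G> \<Longrightarrow> gcomp \<G> g h \<in> arrows \<G>"
    and src_comp: "(g, h) \<in> composable \<G> \<Longrightarrow> src \<G> (gcomp \<G> g h) = src \<G> h"
    and rng_comp: "(g, h) \<in> composable \<G> \<Longrightarrow> rng \<G> (gcomp \<G> g h) = rng \<G> g"
    and comp_assoc: "(g, h) \<in> composable \<G> \<Longrightarrow> (h, k) \<in> composable \<G> \<Longrightarrow>
      gcomp \<G> (gcomp \<G> g h) k = gcomp \<G> g (gcomp \<G> h k)"
    and comp_src: "g \<in> arrows \<G> \<Longrightarrow> gcomp \<G> g (src \<G> g) = g"
    and rng_comp_self: "g \<in> arrows \<G> \<Longrightarrow> gcomp \<G> (rng \<G> g) g = g"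

locale topological_groupoid = groupoid +
  assumes continuous_comp:
      "continuous_map (subtopology (prod_topology (top_of \<G>) (top_of \<G>)) (composable \<G>))
         (top_of \<G>) (\<lambda>(g, h). gcomp \<G> g h)"
    and continuous_inv: "continuous_map (top_of \<G>) (top_of \<G>) (ginv \<G>)"

definition local_homeomorphism :: "'a topology \<Rightarrow> 'b topology \<Rightarrow> ('a \<Rightarrow> 'b) \<Rightarrow> bool" where
  "local_homeomorphism X Y f \<longleftrightarrow> f \<in> topspace X \<rightarrow> topspace Y \<and>
     (\<forall>x \<in> topspace X. \<exists>U. openin X U \<and> x \<in> U \<and> openin Y (f ` U) \<and>
        homeomorphic_map (subtopology X U) (subtopology Y (f ` U)) f)"

locale etale_groupoid = topological_groupoid +
  assumes locally_compact: "locally_compact_space (top_of \<G>)"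
    and locally_compact_units: "locally_compact_space (subtopology (top_of \<G>) (units \<G>))"
    and Hausdorff_units: "Hausdorff_space (subtopology (top_of \<G>) (units \<G>))"
    and local_homeomorphism_src:
      "local_homeomorphism (top_of \<G>) (subtopology (top_of \<G>) (units \<G>)) (src \<G>)"

text \<open>Compact sets are Hausdorff by convention, whereas \<^const>\<open>compactin\<close> does not require it.\<close>

definition compact_Hausdorffin :: "'a topology \<Rightarrow> 'a set \<Rightarrow> bool" where
  "compact_Hausdorffin X U \<longleftrightarrow> compactin X U \<and> Hausdorff_space (subtopology X U)"

definition slice :: "'g top_groupoid \<Rightarrow> 'g set \<Rightarrow> bool" where
  "slice \<G> U \<longleftrightarrow> openin (top_of \<G>) U \<and> inj_on (src \<G>) U \<and> inj_on (rng \<G>) U"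

definition compact_slice :: "'g top_groupoid \<Rightarrow> 'g set \<Rightarrow> bool" where
  "compact_slice \<G> U \<longleftrightarrow> slice \<G> U \<and> compact_Hausdorffin (top_of \<G>) U"

locale ample_groupoid = etale_groupoid +
  assumes compact_slices_basis: "openin (top_of \<G>) = arbitrary union_of compact_slice \<G>"

definition isotropy_group :: "'g top_groupoid \<Rightarrow> 'g \<Rightarrow> 'g monoid" where
  "isotropy_group \<G> x =
     \<lparr>carrier = {g \<in> arrows \<G>. src \<G> g = x \<and> rng \<G> g = x}, mult = gcomp \<G>, one = x\<rparr>"


section \<open>Modules over a possibly non-unital algebra\<close>

text \<open>
  The sort \<open>{comm_ring, comm_monoid_mult}\<close> describes commutative rings with unit; in contrast
  to \<^class>\<open>comm_ring_1\<close> it admits the zero ring. The addition of an algebra is that of its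
  ambient type.
\<close>

record ('k, 'a) kalgebra =
  acarrier :: "'a set"
  amult :: "'a \<Rightarrow> 'a \<Rightarrow> 'a"
  ascale :: "'k \<Rightarrow> 'a \<Rightarrow> 'a"

locale algebra_module =
  fixes A :: "('k::{comm_ring, comm_monoid_mult}, 'a::ab_group_add) kalgebra"
    and smul :: "'k \<Rightarrow> 'v::ab_group_add \<Rightarrow> 'v"
    and act :: "'a \<Rightarrow> 'v \<Rightarrow> 'v"
    and M :: "'v set"
  assumes zero_closed: "0 \<in> M"
    and add_closed: "v \<in> M \<Longrightarrow> w \<in> M \<Longrightarrow> v + w \<in> M"
    and scale_closed: "v \<in> M \<Longrightarrow> smul c v \<in> M"
    and scale_add_right: "v \<in> M \<Longrightarrow> w \<in> M \<Longrightarrow> smul c (v + w) = smul c v + smul c w"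
    and scale_add_left: "v \<in> M \<Longrightarrow> smul (c + d) v = smul c v + smul d v"
    and scale_scale: "v \<in> M \<Longrightarrow> smul c (smul d v) = smul (c * d) v"
    and scale_one: "v \<in> M \<Longrightarrow> smul 1 v = v"
    and act_closed: "a \<in> acarrier A \<Longrightarrow> v \<in> M \<Longrightarrow> act a v \<in> M"
    and act_add_right: "a \<in> acarrier A \<Longrightarrow> v \<in> M \<Longrightarrow> w \<in> M \<Longrightarrow>
      act a (v + w) = act a v + act a w"
    and act_add_left: "a \<in> acarrier A \<Longrightarrow> b \<in> acarrier A \<Longrightarrow> v \<in> M \<Longrightarrow>
      act (a + b) v = act a v + act b v"
    and act_scale_right: "a \<in> acarrier A \<Longrightarrow> v \<in> M \<Longrightarrow> act a (smul c v) = smul c (act a v)"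
    and act_scale_left: "a \<in> acarrier A \<Longrightarrow> v \<in> M \<Longrightarrow> act (ascale A c a) v = smul c (act a v)"
    and act_mult: "a \<in> acarrier A \<Longrightarrow> b \<in> acarrier A \<Longrightarrow> v \<in> M \<Longrightarrow>
      act (amult A a b) v = act a (act b v)"
    and nondegenerate:
      "{\<Sum>i<n. act (a i) (v i) | (n::nat) a v. \<forall>i<n. a i \<in> acarrier A \<and> v i \<in> M} = M"

definition is_submodule ::
  "('k, 'a) kalgebra \<Rightarrow> ('k \<Rightarrow> 'v::ab_group_add \<Rightarrow> 'v) \<Rightarrow> ('a \<Rightarrow> 'v \<Rightarrow> 'v) \<Rightarrow> 'v set \<Rightarrow> 'v set \<Rightarrow> bool"
  where "is_submodule A smul act M N \<longleftrightarrow> N \<subseteq> M \<and> 0 \<in> N \<and> (\<forall>v\<in>N. \<forall>w\<in>N. v + w \<in> N) \<and>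
     (\<forall>c. \<forall>v\<in>N. smul c v \<in> N) \<and> (\<forall>a\<in>acarrier A. \<forall>v\<in>N. act a v \<in> N)"

definition simple_module ::
  "('k::{comm_ring, comm_monoid_mult}, 'a::ab_group_add) kalgebra \<Rightarrow>
     ('k \<Rightarrow> 'v::ab_group_add \<Rightarrow> 'v) \<Rightarrow> ('a \<Rightarrow> 'v \<Rightarrow> 'v) \<Rightarrow> 'v set \<Rightarrow> bool"
  where "simple_module A smul act M \<longleftrightarrow> algebra_module A smul act M \<and> M \<noteq> {0} \<and>
     (\<forall>N. is_submodule A smul act M N \<longrightarrow> N = {0} \<or> N = M)"


section \<open>Group algebras and groupoid algebras\<close>

text \<open>The group algebra consists of the finitely supported functions on the group.\<close>

definition group_algebra ::
  "('g, 'z) monoid_scheme \<Rightarrow> ('k::{comm_ring, comm_monoid_mult}, 'g \<Rightarrow> 'k) kalgebra" where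
  "group_algebra G =
     \<lparr>acarrier = {a. finite {g. a g \<noteq> 0} \<and> {g. a g \<noteq> 0} \<subseteq> carrier G},
      amult = (\<lambda>a b x. if x \<in> carrier G
        then \<Sum>y | y \<in> carrier G \<and> b y \<noteq> 0. a (x \<otimes>\<^bsub>G\<^esub> inv\<^bsub>G\<^esub> y) * b y else 0),
      ascale = (\<lambda>c a g. c * a g)\<rparr>"

definition chi :: "'g set \<Rightarrow> 'g \<Rightarrow> 'k::{comm_ring, comm_monoid_mult}" where
  "chi U = (\<lambda>g. if g \<in> U then 1 else 0)"

definition algebra_generators ::
  "'g top_groupoid \<Rightarrow> ('g \<Rightarrow> 'k::{comm_ring, comm_monoid_mult}) set" where
  "algebra_generators \<G> = {f. \<exists>V. openin (top_of \<G>) V \<and> Hausdorff_space (subtopology (top_of \<G>) V) \<and>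
     (\<forall>g. g \<notin> V \<longrightarrow> f g = 0) \<and>
     continuous_map (subtopology (top_of \<G>) V) (discrete_topology UNIV) f \<and>
     compactin (subtopology (top_of \<G>) V)
       (subtopology (top_of \<G>) V closure_of {g \<in> V. f g \<noteq> 0})}"

text \<open>
  In the convolution product the sum over the fibre of \<open>x\<close> is restricted to the support of \<open>b\<close>:
  the sum of \<^const>\<open>sum\<close> over an infinite set is 0, and the elements of the algebra meet each
  fibre of \<open>src\<close> in a finite set only.
\<close>

definition groupoid_algebra ::
  "'g top_groupoid \<Rightarrow> ('k::{comm_ring, comm_monoid_mult}, 'g \<Rightarrow> 'k) kalgebra" where
  "groupoid_algebra \<G> =
     \<lparr>acarrier = {\<lambda>g. \<Sum>i<n. c i * f i g | (n::nat) c f. \<forall>i<n. f i \<in> algebra_generators \<G>},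
      amult = (\<lambda>a b x. if x \<in> arrows \<G>
        then \<Sum>y | y \<in> arrows \<G> \<and> src \<G> y = src \<G> x \<and> b y \<noteq> 0. a (gcomp \<G> x (ginv \<G> y)) * b y
        else 0),
      ascale = (\<lambda>c a g. c * a g)\<rparr>"


section \<open>Restriction to the isotropy group\<close>

definition res ::
  "'g top_groupoid \<Rightarrow> (('g \<Rightarrow> 'k::{comm_ring, comm_monoid_mult}) \<Rightarrow> 'v \<Rightarrow> 'v) \<Rightarrow> 'v set \<Rightarrow> 'g \<Rightarrow> 'v set"
  where "res \<G> act V x =
    (\<Inter>U \<in> {U. openin (top_of \<G>) U \<and> compact_Hausdorffin (top_of \<G>) U \<and> U \<subseteq> units \<G> \<and> x \<in> U}.
       act (chi U) ` V)"

text \<open>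
  The value \<open>g w = \<chi>\<^sub>U w\<close> does not depend on the compact slice \<open>U\<close> containing \<open>g\<close> if \<open>w\<close> lies
  in \<^term>\<open>res \<G> act V x\<close> and \<open>g\<close> in the isotropy group at \<open>x\<close>.
\<close>

definition isotropy_act ::
  "'g top_groupoid \<Rightarrow> (('g \<Rightarrow> 'k::{comm_ring, comm_monoid_mult}) \<Rightarrow> 'v \<Rightarrow> 'v) \<Rightarrow> 'g \<Rightarrow> 'v \<Rightarrow> 'v"
  where "isotropy_act \<G> act g w = (THE v. \<exists>U. compact_slice \<G> U \<and> g \<in> U \<and> v = act (chi U) w)"

definition res_act ::
  "'g top_groupoid \<Rightarrow> ('k::{comm_ring, comm_monoid_mult} \<Rightarrow> 'v::ab_group_add \<Rightarrow> 'v) \<Rightarrow>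
     (('g \<Rightarrow> 'k) \<Rightarrow> 'v \<Rightarrow> 'v) \<Rightarrow> ('g \<Rightarrow> 'k) \<Rightarrow> 'v \<Rightarrow> 'v"
  where "res_act \<G> smul act a w = (\<Sum>g | a g \<noteq> 0. smul (a g) (isotropy_act \<G> act g w))"

end

theory Submission
  imports Defs
begin

text \<open>
  Every arrow \<open>g\<close>, not only those in the isotropy group at \<open>x\<close>, acts through slices as a map from
  the restriction at \<open>src g\<close> to the restriction at \<open>rng g\<close>, compatibly with composition, and
  \<open>\<chi>\<^sub>S\<close> acts on the restriction at a unit \<open>y\<close> as the unique arrow of \<open>S\<close> with source \<open>y\<close>, or as
  zero if there is none. As the groupoid algebra is spanned by the \<open>\<chi>\<^sub>S\<close>, the sums of elements
  \<open>g n\<close> with \<open>src g = x\<close> and \<open>n\<close> in a given submodule \<open>N\<close> of the restriction at \<open>x\<close> form a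
  submodule of \<open>V\<close>. If \<open>N\<close> is nonzero this is all of \<open>V\<close>, and applying \<open>\<chi>\<^sub>U\<close> for a small
  neighbourhood \<open>U\<close> of \<open>x\<close> shows that every element of the restriction at \<open>x\<close> lies in \<open>N\<close>.
\<close>

section \<open>Modules over group algebras\<close>

text \<open>Split off from \<open>algebra_module\<close> so that the lemmas on finite sums serve
  both \<open>V\<close> and its restrictions, for which the module structure over the group algebra
  is still to be built.\<close>

locale scalar_module =
  fixes smul :: "'k::{comm_ring, comm_monoid_mult} \<Rightarrow> 'v::ab_group_add \<Rightarrow> 'v" and M :: "'v set"
  assumes zero_mem: "0 \<in> M"
    and add_mem: "v \<in> M \<Longrightarrow> w \<in> M \<Longrightarrow> v + w \<in> M"
    and smul_mem: "v \<in> M \<Longrightarrow> smul c v \<in> M"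
    and smul_add: "v \<in> M \<Longrightarrow> w \<in> M \<Longrightarrow> smul c (v + w) = smul c v + smul c w"
    and add_smul: "v \<in> M \<Longrightarrow> smul (c + d) v = smul c v + smul d v"
    and smul_smul: "v \<in> M \<Longrightarrow> smul c (smul d v) = smul (c * d) v"
    and one_smul: "v \<in> M \<Longrightarrow> smul 1 v = v"
begin

lemma smul_zero: "smul c 0 = 0"
  using smul_add[of 0 0 c] zero_mem by simp

lemma zero_smul: "v \<in> M \<Longrightarrow> smul 0 v = 0"
  using add_smul[of v 0 0] by simp

lemma sum_mem: "(\<And>i. i \<in> I \<Longrightarrow> f i \<in> M) \<Longrightarrow> sum f I \<in> M"
  by (induction I rule: infinite_finite_induct) (auto simp: zero_mem add_mem)

lemma smul_sum: "(\<And>i. i \<in> I \<Longrightarrow> f i \<in> M) \<Longrightarrow> smul c (sum f I) = (\<Sum>i\<in>I. smul c (f i))"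
  by (induction I rule: infinite_finite_induct) (auto simp: smul_zero smul_add sum_mem)

lemma sum_smul: "v \<in> M \<Longrightarrow> smul (sum f I) v = (\<Sum>i\<in>I. smul (f i) v)"
  by (induction I rule: infinite_finite_induct) (auto simp: zero_smul add_smul)

lemma additive_sum:
  fixes F :: "'v \<Rightarrow> 'v"
  assumes "\<And>v w. v \<in> M \<Longrightarrow> w \<in> M \<Longrightarrow> F (v + w) = F v + F w" "\<And>i. i \<in> I \<Longrightarrow> f i \<in> M"
  shows "F (sum f I) = (\<Sum>i\<in>I. F (f i))"
proof -
  have "F 0 = 0"
    using assms(1)[of 0 0] zero_mem by simp
  then show ?thesis
    using assms(2)
    by (induction I rule: infinite_finite_induct) (auto simp: assms(1) sum_mem)
qed

end

sublocale algebra_module \<subseteq> scalars: scalar_module smul M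
  by unfold_locales
    (rule zero_closed add_closed scale_closed scale_add_right scale_add_left scale_scale scale_one;
      assumption?)+

context algebra_module
begin

lemma act_zero: "a \<in> acarrier A \<Longrightarrow> act a 0 = 0"
  using act_add_right[of a 0 0] zero_closed by simp

lemma zero_act: "0 \<in> acarrier A \<Longrightarrow> v \<in> M \<Longrightarrow> act 0 v = 0"
  using act_add_left[of 0 0 v] by simp

end

section \<open>Linear representations of a group\<close>

locale group_representation = group G + scalar_module smul M
  for G :: "('g, 'z) monoid_scheme" (structure)
    and smul :: "'k::{comm_ring, comm_monoid_mult} \<Rightarrow> 'v::ab_group_add \<Rightarrow> 'v" and M +
  fixes \<alpha> :: "'g \<Rightarrow> 'v \<Rightarrow> 'v"
  assumes rep_mem: "g \<in> carrier G \<Longrightarrow> v \<in> M \<Longrightarrow> \<alpha> g v \<in> M"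
    and rep_add: "g \<in> carrier G \<Longrightarrow> v \<in> M \<Longrightarrow> w \<in> M \<Longrightarrow> \<alpha> g (v + w) = \<alpha> g v + \<alpha> g w"
    and rep_smul: "g \<in> carrier G \<Longrightarrow> v \<in> M \<Longrightarrow> \<alpha> g (smul c v) = smul c (\<alpha> g v)"
    and rep_mult: "g \<in> carrier G \<Longrightarrow> h \<in> carrier G \<Longrightarrow> v \<in> M \<Longrightarrow> \<alpha> (g \<otimes> h) v = \<alpha> g (\<alpha> h v)"
    and rep_one: "v \<in> M \<Longrightarrow> \<alpha> \<one> v = v"
begin

text \<open>The formula of \<open>res_act\<close> for an arbitrary representation
  \<open>\<alpha>\<close>, which separates the algebra of convolution from the topology of the
  groupoid.\<close>

definition algebra_act :: "('g \<Rightarrow> 'k) \<Rightarrow> 'v \<Rightarrow> 'v" where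
  "algebra_act a v = (\<Sum>g | a g \<noteq> 0. smul (a g) (\<alpha> g v))"

lemma acarrier_iff:
  "a \<in> acarrier (group_algebra G) \<longleftrightarrow> finite {g. a g \<noteq> 0} \<and> {g. a g \<noteq> 0} \<subseteq> carrier G"
  by (simp add: group_algebra_def)

text \<open>Terms off the support vanish. Enlarging the index set allows different elements of the
  group algebra to be summed over a common finite set.\<close>

lemma algebra_act_eq:
  assumes "finite F" "F \<subseteq> carrier G" "{g. a g \<noteq> 0} \<subseteq> F" "v \<in> M"
  shows "algebra_act a v = (\<Sum>g\<in>F. smul (a g) (\<alpha> g v))"
  unfolding algebra_act_def using assms
  by (intro sum.mono_neutral_left) (auto simp: zero_smul rep_mem)

lemma algebra_act_mem:
  "a \<in> acarrier (group_algebra G) \<Longrightarrow> v \<in> M \<Longrightarrow> algebra_act a v \<in> M"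
  unfolding algebra_act_def acarrier_iff by (intro sum_mem smul_mem rep_mem) auto

lemma algebra_act_chi:
  assumes "g \<in> carrier G" "v \<in> M"
  shows "(chi {g} :: 'g \<Rightarrow> 'k) \<in> acarrier (group_algebra G)" "algebra_act (chi {g}) v = \<alpha> g v"
proof -
  \<comment> \<open>Only an inclusion: over the zero ring this support is empty.\<close>
  have *: "{h. chi {g} h \<noteq> (0::'k)} \<subseteq> {g}"
    by (auto simp: chi_def)
  show "(chi {g} :: 'g \<Rightarrow> 'k) \<in> acarrier (group_algebra G)"
    unfolding acarrier_iff using finite_subset[OF *] * assms(1) by auto
  show "algebra_act (chi {g}) v = \<alpha> g v"
    using algebra_act_eq[of "{g}" "chi {g}" v] assms * by (simp add: chi_def one_smul rep_mem)
qed

text \<open>Expanding the convolution and exchanging the sums leaves a sum over \<open>z\<close> for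
  each fixed \<open>y\<close>; substituting \<open>z = x y\<close> turns it into the double sum
  given by the two successive actions.\<close>

lemma algebra_act_mult:
  assumes "a \<in> acarrier (group_algebra G)" "b \<in> acarrier (group_algebra G)" "v \<in> M"
  shows "algebra_act (amult (group_algebra G) a b) v = algebra_act a (algebra_act b v)"
proof -
  let ?A = "{g. a g \<noteq> 0}" and ?B = "{g. b g \<noteq> 0}"
  let ?c = "amult (group_algebra G) a b"
  \<comment> \<open>\<open>F\<close> contains the support of the convolution, possibly strictly
    because terms can cancel; it serves as a finite index set.\<close>
  define F where "F = (\<lambda>(g, h). g \<otimes> h) ` (?A \<times> ?B)"
  have A: "finite ?A" "?A \<subseteq> carrier G" and B: "finite ?B" "?B \<subseteq> carrier G"
    using assms by (auto simp: acarrier_iff)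
  have F: "finite F" "F \<subseteq> carrier G"
    using A B by (auto simp: F_def)
  have B': "{y. y \<in> carrier G \<and> b y \<noteq> 0} = ?B"
    using B by auto
  have c: "?c z = (\<Sum>y\<in>?B. a (z \<otimes> inv y) * b y)" if "z \<in> carrier G" for z
    using that B' by (simp add: group_algebra_def)
  have "?c z = 0" if "z \<notin> F" for z
  proof (cases "z \<in> carrier G")
    case True
    have "a (z \<otimes> inv y) = 0" if "y \<in> ?B" for y
    proof (rule ccontr)
      assume "a (z \<otimes> inv y) \<noteq> 0"
      then have "(z \<otimes> inv y) \<otimes> y \<in> F"
        using \<open>y \<in> ?B\<close> unfolding F_def by blast
      moreover have "(z \<otimes> inv y) \<otimes> y = z"
        using True \<open>y \<in> ?B\<close> B by (simp add: m_assoc subset_iff)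
      ultimately show False
        using \<open>z \<notin> F\<close> by simp
    qed
    then show ?thesis
      using c[OF True] by simp
  qed (simp add: group_algebra_def)
  then have "algebra_act ?c v = (\<Sum>z\<in>F. smul (?c z) (\<alpha> z v))"
    using F assms(3) by (intro algebra_act_eq) auto
  also have "\<dots> = (\<Sum>z\<in>F. \<Sum>y\<in>?B. smul (a (z \<otimes> inv y) * b y) (\<alpha> z v))"
    using F assms(3) by (intro sum.cong refl) (auto simp: c sum_smul rep_mem subset_iff)
  also have "\<dots> = (\<Sum>y\<in>?B. \<Sum>z\<in>F. smul (a (z \<otimes> inv y) * b y) (\<alpha> z v))"
    by (rule sum.swap)
  also have "\<dots> = (\<Sum>y\<in>?B. \<Sum>x\<in>?A. smul (a x) (\<alpha> x (smul (b y) (\<alpha> y v))))"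
  proof (rule sum.cong[OF refl])
    fix y assume y: "y \<in> ?B"
    then have yG: "y \<in> carrier G"
      using B by blast
    \<comment> \<open>For fixed \<open>y\<close> only the right translate by \<open>y\<close> of the
      support of \<open>a\<close> contributes to the sum over \<open>F\<close>.\<close>
    have cancel: "z \<in> (\<lambda>x. x \<otimes> y) ` ?A" if "z \<in> F" "a (z \<otimes> inv y) \<noteq> 0" for z
    proof
      show "z = (z \<otimes> inv y) \<otimes> y"
        using that(1) F yG by (simp add: m_assoc subset_iff)
    qed (use that in auto)
    have "(\<Sum>z\<in>F. smul (a (z \<otimes> inv y) * b y) (\<alpha> z v)) =
      (\<Sum>z\<in>(\<lambda>x. x \<otimes> y) ` ?A. smul (a (z \<otimes> inv y) * b y) (\<alpha> z v))"
    proof (rule sum.mono_neutral_right)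
      show "(\<lambda>x. x \<otimes> y) ` ?A \<subseteq> F"
        using y by (auto simp: F_def)
      show "\<forall>z\<in>F - (\<lambda>x. x \<otimes> y) ` ?A. smul (a (z \<otimes> inv y) * b y) (\<alpha> z v) = 0"
      proof
        fix z assume z: "z \<in> F - (\<lambda>x. x \<otimes> y) ` ?A"
        then have "a (z \<otimes> inv y) = 0"
          using cancel by blast
        then show "smul (a (z \<otimes> inv y) * b y) (\<alpha> z v) = 0"
          using z F assms(3) by (auto simp: zero_smul rep_mem subset_iff)
      qed
    qed (rule F)
    also have "\<dots> = (\<Sum>x\<in>?A. smul (a (x \<otimes> y \<otimes> inv y) * b y) (\<alpha> (x \<otimes> y) v))"
      using A yG by (subst sum.reindex) (auto simp: inj_on_def subset_iff)
    also have "\<dots> = (\<Sum>x\<in>?A. smul (a x) (\<alpha> x (smul (b y) (\<alpha> y v))))"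
      using A yG assms(3)
      by (intro sum.cong refl)
        (auto simp: m_assoc rep_mult rep_smul rep_mem smul_smul subset_iff)
    finally show "(\<Sum>z\<in>F. smul (a (z \<otimes> inv y) * b y) (\<alpha> z v)) =
      (\<Sum>x\<in>?A. smul (a x) (\<alpha> x (smul (b y) (\<alpha> y v))))" .
  qed
  also have "\<dots> = (\<Sum>x\<in>?A. \<Sum>y\<in>?B. smul (a x) (\<alpha> x (smul (b y) (\<alpha> y v))))"
    by (rule sum.swap)
  also have "\<dots> = algebra_act a (algebra_act b v)"
    unfolding algebra_act_def[of a] algebra_act_def[of b v]
  proof (intro sum.cong refl)
    fix x assume "x \<in> ?A"
    then have x: "x \<in> carrier G"
      using A by blast
    have mem: "smul (b y) (\<alpha> y v) \<in> M" if "y \<in> ?B" for y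
      using that B assms(3) by (auto intro: smul_mem rep_mem)
    have "\<alpha> x (\<Sum>y\<in>?B. smul (b y) (\<alpha> y v)) = (\<Sum>y\<in>?B. \<alpha> x (smul (b y) (\<alpha> y v)))"
      using mem by (intro additive_sum rep_add x)
    then show "(\<Sum>y\<in>?B. smul (a x) (\<alpha> x (smul (b y) (\<alpha> y v)))) =
      smul (a x) (\<alpha> x (\<Sum>y\<in>?B. smul (b y) (\<alpha> y v)))"
      using mem x by (subst smul_sum[symmetric]) (auto simp: rep_mem)
  qed
  finally show ?thesis .
qed

lemma algebra_module: "algebra_module (group_algebra G) smul algebra_act M"
proof
  show "algebra_act a (v + w) = algebra_act a v + algebra_act a w"
    if "a \<in> acarrier (group_algebra G)" "v \<in> M" "w \<in> M" for a v w
    using that unfolding algebra_act_def acarrier_iff sum.distrib[symmetric]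
    by (intro sum.cong) (auto simp: rep_add smul_add rep_mem subset_iff)
  show "algebra_act (a + b) v = algebra_act a v + algebra_act b v"
    if "a \<in> acarrier (group_algebra G)" "b \<in> acarrier (group_algebra G)" "v \<in> M" for a b v
  proof -
    let ?F = "{g. a g \<noteq> 0} \<union> {g. b g \<noteq> 0}"
    have F: "finite ?F" "?F \<subseteq> carrier G"
      using that by (auto simp: acarrier_iff)
    have sum_F: "algebra_act c v = (\<Sum>g\<in>?F. smul (c g) (\<alpha> g v))"
      if "{g. c g \<noteq> 0} \<subseteq> ?F" for c
      using F that \<open>v \<in> M\<close> by (rule algebra_act_eq)
    have "{g. (a + b) g \<noteq> 0} \<subseteq> ?F"
      by auto
    note sum_F[OF this] sum_F[of a, OF Un_upper1] sum_F[of b, OF Un_upper2]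
    moreover have "smul ((a + b) g) (\<alpha> g v) = smul (a g) (\<alpha> g v) + smul (b g) (\<alpha> g v)"
      if "g \<in> ?F" for g
      using that F \<open>v \<in> M\<close> by (simp only: plus_fun_apply) (blast intro: add_smul rep_mem)
    ultimately show ?thesis
      by (simp only: sum.distrib[symmetric] cong: sum.cong)
  qed
  show "algebra_act a (smul c v) = smul c (algebra_act a v)"
    if "a \<in> acarrier (group_algebra G)" "v \<in> M" for a c v
  proof -
    have *: "g \<in> carrier G" if "a g \<noteq> 0" for g
      using that \<open>a \<in> _\<close> by (auto simp: acarrier_iff)
    \<comment> \<open>Commutativity of the scalars moves \<open>c\<close> past the coefficients of
      \<open>a\<close>.\<close>
    show ?thesis
      unfolding algebra_act_def using \<open>v \<in> M\<close>
      by (subst smul_sum)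
        (auto simp: * smul_mem rep_mem rep_smul smul_smul mult.commute[of c] intro!: sum.cong)
  qed
  show "algebra_act (ascale (group_algebra G) c a) v = smul c (algebra_act a v)"
    if "a \<in> acarrier (group_algebra G)" "v \<in> M" for a c v
  proof -
    have fin: "finite {g. a g \<noteq> 0}" and *: "{g. a g \<noteq> 0} \<subseteq> carrier G"
      using that by (auto simp: acarrier_iff)
    have "algebra_act (ascale (group_algebra G) c a) v =
      (\<Sum>g | a g \<noteq> 0. smul (ascale (group_algebra G) c a g) (\<alpha> g v))"
      using fin * that(2) by (intro algebra_act_eq) (auto simp: group_algebra_def)
    also have "\<dots> = smul c (algebra_act a v)"
      unfolding algebra_act_def using * that(2)
      by (subst smul_sum)
        (auto simp: group_algebra_def smul_mem rep_mem smul_smul subset_iff intro!: sum.cong)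
    finally show ?thesis .
  qed
  show "{\<Sum>i<n. algebra_act (a i) (v i) | (n::nat) a v.
      \<forall>i<n. a i \<in> acarrier (group_algebra G) \<and> v i \<in> M} = M" (is "?S = M")
  proof
    show "?S \<subseteq> M"
      by (auto intro!: sum_mem algebra_act_mem)
    show "M \<subseteq> ?S"
    proof
      fix v assume v: "v \<in> M"
      \<comment> \<open>One summand is enough, because \<open>chi {\<one>}\<close> acts as the
        identity.\<close>
      show "v \<in> ?S"
      proof (intro CollectI exI conjI)
        show "v = (\<Sum>i<Suc 0. algebra_act (chi {\<one>}) v)"
          using v by (simp add: algebra_act_chi rep_one)
        show "\<forall>i<Suc 0. (chi {\<one>} :: 'g \<Rightarrow> 'k) \<in> acarrier (group_algebra G) \<and> v \<in> M"
          using algebra_act_chi(1)[OF one_closed v] v by blast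
      qed
    qed
  qed
qed (rule zero_mem add_mem smul_mem smul_add add_smul smul_smul one_smul algebra_act_mem
    algebra_act_mult; assumption?)+

end

section \<open>Arrows and slices\<close>

context groupoid
begin

lemma composable_iff: "(g, h) \<in> composable \<G> \<longleftrightarrow> g \<in> arrows \<G> \<and> h \<in> arrows \<G> \<and> src \<G> g = rng \<G> h"
  by (simp add: composable_def)

lemma src_arrow: "g \<in> arrows \<G> \<Longrightarrow> src \<G> g \<in> arrows \<G>"
  unfolding src_def[of \<G> g] by (rule comp_closed) (simp add: composable_iff inv_closed src_inv)

lemma src_src: "g \<in> arrows \<G> \<Longrightarrow> src \<G> (src \<G> g) = src \<G> g"
  using src_comp[of "ginv \<G> g" g] by (simp add: composable_iff inv_closed src_inv flip: src_def)

lemma rng_src: "g \<in> arrows \<G> \<Longrightarrow> rng \<G> (src \<G> g) = src \<G> g"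
  using rng_comp[of "ginv \<G> g" g]
  by (simp add: composable_iff inv_closed src_inv rng_inv flip: src_def)

lemma unitsD:
  assumes "u \<in> units \<G>"
  shows "u \<in> arrows \<G>" "src \<G> u = u" "rng \<G> u = u"
  using assms by (auto simp: units_def src_arrow src_src rng_src)

lemma src_units: "g \<in> arrows \<G> \<Longrightarrow> src \<G> g \<in> units \<G>"
  by (simp add: units_def)

lemma rng_units: "g \<in> arrows \<G> \<Longrightarrow> rng \<G> g \<in> units \<G>"
  by (metis inv_closed src_inv src_units)

lemma units_subset: "units \<G> \<subseteq> arrows \<G>"
  using unitsD by blast

lemma comp_inv_cancel:
  assumes "g \<in> arrows \<G>" "h \<in> arrows \<G>" "src \<G> g = src \<G> h"
  shows "gcomp \<G> g (ginv \<G> h) \<in> arrows \<G>" "src \<G> (gcomp \<G> g (ginv \<G> h)) = rng \<G> h"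
    "gcomp \<G> (gcomp \<G> g (ginv \<G> h)) h = g"
proof -
  have 1: "(g, ginv \<G> h) \<in> composable \<G>" "(ginv \<G> h, h) \<in> composable \<G>"
    using assms by (auto simp: composable_iff inv_closed rng_inv src_inv)
  show "gcomp \<G> g (ginv \<G> h) \<in> arrows \<G>"
    using 1 by (simp add: comp_closed)
  show "src \<G> (gcomp \<G> g (ginv \<G> h)) = rng \<G> h"
    using 1 assms by (simp add: src_comp src_inv)
  show "gcomp \<G> (gcomp \<G> g (ginv \<G> h)) h = g"
    using 1 assms comp_src[of g] by (simp add: comp_assoc flip: src_def)
qed

lemma comp_cancel_inv:
  assumes "(g, h) \<in> composable \<G>"
  shows "gcomp \<G> (gcomp \<G> g h) (ginv \<G> h) = g"
proof -
  have "(h, ginv \<G> h) \<in> composable \<G>"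
    using assms by (auto simp: composable_iff inv_closed rng_inv)
  then show ?thesis
    using assms comp_src[of g] by (simp add: comp_assoc composable_iff flip: rng_def)
qed

lemma group_isotropy_group:
  assumes "x \<in> units \<G>"
  shows "group (isotropy_group \<G> x)"
proof -
  let ?C = "{g \<in> arrows \<G>. src \<G> g = x \<and> rng \<G> g = x}"
  have composable: "(g, h) \<in> composable \<G>" if "g \<in> ?C" "h \<in> ?C" for g h
    using that by (simp add: composable_iff)
  show ?thesis
  proof (rule groupI; unfold isotropy_group_def partial_object.simps monoid.simps)
    show "x \<in> ?C"
      using unitsD[OF assms] by simp
  next
    fix g h assume "g \<in> ?C" "h \<in> ?C"
    then show "gcomp \<G> g h \<in> ?C"
      using composable[of g h] by (simp add: comp_closed src_comp rng_comp)
  next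
    fix g h k assume "g \<in> ?C" "h \<in> ?C" "k \<in> ?C"
    then show "gcomp \<G> (gcomp \<G> g h) k = gcomp \<G> g (gcomp \<G> h k)"
      by (intro comp_assoc composable)
  next
    fix g assume g: "g \<in> ?C"
    then show "gcomp \<G> x g = g"
      using rng_comp_self[of g] by simp
    show "\<exists>h\<in>?C. gcomp \<G> h g = x"
      using g by (intro bexI[of _ "ginv \<G> g"])
        (simp_all add: inv_closed src_inv rng_inv flip: src_def)
  qed
qed

section \<open>Products of sets of arrows and convolution\<close>

text \<open>The condition of composability is explicit because \<open>gcomp\<close> has arbitrary
  values on other pairs.\<close>

definition set_comp :: "'g set \<Rightarrow> 'g set \<Rightarrow> 'g set" where
  "set_comp S T = {gcomp \<G> s t | s t. s \<in> S \<and> t \<in> T \<and> (s, t) \<in> composable \<G>}"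

text \<open>The only unit composable with \<open>s\<close> on the right is
  \<open>src \<G> s\<close>, and multiplying by it changes nothing. Hence characteristic functions
  of sets of units localize slices.\<close>

lemma set_comp_units_right:
  assumes "S \<subseteq> arrows \<G>" "U \<subseteq> units \<G>"
  shows "set_comp S U = {s \<in> S. src \<G> s \<in> U}"
proof (intro equalityI subsetI)
  fix y assume "y \<in> set_comp S U"
  then obtain s u where su: "y = gcomp \<G> s u" "s \<in> S" "u \<in> U" "(s, u) \<in> composable \<G>"
    unfolding set_comp_def by blast
  then have "u = src \<G> s"
    using assms unitsD(3)[of u] by (auto simp: composable_iff)
  then show "y \<in> {s \<in> S. src \<G> s \<in> U}"
    using su comp_src[of s] by (simp add: composable_iff)
next
  fix s assume s: "s \<in> {s \<in> S. src \<G> s \<in> U}"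
  then have "s \<in> arrows \<G>"
    using assms by blast
  then have "(s, src \<G> s) \<in> composable \<G>" "s = gcomp \<G> s (src \<G> s)"
    by (simp_all add: composable_iff src_arrow rng_src comp_src)
  then show "s \<in> set_comp S U"
    unfolding set_comp_def using s by blast
qed

lemma set_comp_units_left:
  assumes "S \<subseteq> arrows \<G>" "U \<subseteq> units \<G>"
  shows "set_comp U S = {s \<in> S. rng \<G> s \<in> U}"
proof (intro equalityI subsetI)
  fix y assume "y \<in> set_comp U S"
  then obtain s u where su: "y = gcomp \<G> u s" "s \<in> S" "u \<in> U" "(u, s) \<in> composable \<G>"
    unfolding set_comp_def by blast
  then have "u = rng \<G> s"
    using assms unitsD(2)[of u] by (auto simp: composable_iff)
  then show "y \<in> {s \<in> S. rng \<G> s \<in> U}"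
    using su rng_comp_self[of s] by (simp add: composable_iff)
next
  fix s assume s: "s \<in> {s \<in> S. rng \<G> s \<in> U}"
  then have "s \<in> arrows \<G>"
    using assms by blast
  then have "(rng \<G> s, s) \<in> composable \<G>" "s = gcomp \<G> (rng \<G> s) s"
    using unitsD[OF rng_units, of s] by (simp_all add: composable_iff rng_comp_self)
  then show "s \<in> set_comp U S"
    unfolding set_comp_def using s by blast
qed

text \<open>Since the source is injective on \<open>T\<close>, at most one \<open>y\<close> in the
  fibre of \<open>x\<close> contributes to the convolution sum, and its term is 1 or 0 according to
  whether \<open>x\<close> times the inverse of \<open>y\<close> lies in \<open>S\<close>.\<close>

lemma amult_chi:
  assumes "S \<subseteq> arrows \<G>" "T \<subseteq> arrows \<G>" "inj_on (src \<G>) T"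
  shows "amult (groupoid_algebra \<G>) (chi S) (chi T) =
    (chi (set_comp S T) :: 'g \<Rightarrow> 'k::{comm_ring, comm_monoid_mult})"
proof (cases "(1::'k) = 0")
  \<comment> \<open>In the zero ring the support of \<open>chi T\<close> is empty, whatever \<open>T\<close> is.\<close>
  case True
  then have "c = d" for c d :: 'k
    by (metis mult_1_right mult_zero_right)
  then show ?thesis
    by blast
next
  case False
  show ?thesis
  proof
    fix x
    show "amult (groupoid_algebra \<G>) (chi S) (chi T) x = (chi (set_comp S T) x :: 'k)"
    proof (cases "x \<in> arrows \<G>")
      case True
      let ?Y = "{y. y \<in> arrows \<G> \<and> src \<G> y = src \<G> x \<and> (chi T y :: 'k) \<noteq> 0}"
      have Y: "?Y = {y \<in> T. src \<G> y = src \<G> x}"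
        using assms False by (auto simp: chi_def)
      have lhs: "amult (groupoid_algebra \<G>) (chi S) (chi T) x =
        (\<Sum>y\<in>?Y. chi S (gcomp \<G> x (ginv \<G> y)) * (chi T y :: 'k))"
        using True by (simp add: groupoid_algebra_def)
      show ?thesis
      proof (cases "\<exists>y\<in>T. src \<G> y = src \<G> x")
        case ex: True
        then obtain y where y: "y \<in> T" "src \<G> y = src \<G> x"
          by blast
        then have "?Y = {y}"
          unfolding Y using assms(3) by (auto simp: inj_on_def)
        then have lhs': "amult (groupoid_algebra \<G>) (chi S) (chi T) x =
            (chi S (gcomp \<G> x (ginv \<G> y)) :: 'k)"
          unfolding lhs using y by (simp add: chi_def)
        have yG: "y \<in> arrows \<G>"
          using y assms by blast
        note c = comp_inv_cancel[OF True yG y(2)[symmetric]]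
        have "gcomp \<G> x (ginv \<G> y) \<in> S \<longleftrightarrow> x \<in> set_comp S T"
        proof
          assume "gcomp \<G> x (ginv \<G> y) \<in> S"
          moreover have "(gcomp \<G> x (ginv \<G> y), y) \<in> composable \<G>"
            using c yG by (simp add: composable_iff)
          ultimately show "x \<in> set_comp S T"
            unfolding set_comp_def using y c(3)[symmetric] by blast
        next
          assume "x \<in> set_comp S T"
          then obtain s t where st: "x = gcomp \<G> s t" "s \<in> S" "t \<in> T" "(s, t) \<in> composable \<G>"
            unfolding set_comp_def by blast
          then have "src \<G> t = src \<G> y"
            using y by (simp add: src_comp)
          then have "t = y"
            using st y assms(3) by (auto simp: inj_on_def)
          then show "gcomp \<G> x (ginv \<G> y) \<in> S"
            using st by (simp add: comp_cancel_inv)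
        qed
        then show ?thesis
          unfolding lhs' by (simp add: chi_def)
      next
        case nex: False
        then have "?Y = {}"
          unfolding Y by blast
        moreover have "x \<notin> set_comp S T"
          using nex unfolding set_comp_def by (auto simp: src_comp)
        ultimately show ?thesis
          unfolding lhs by (simp add: chi_def)
      qed
    next
      case False
      then have "x \<notin> set_comp S T"
        unfolding set_comp_def by (auto simp: comp_closed)
      with False show ?thesis
        by (simp add: groupoid_algebra_def chi_def)
    qed
  qed
qed

end

section \<open>Compact slices and the groupoid algebra\<close>

context etale_groupoid
begin

section \<open>Continuity and openness of the source map\<close>

lemma continuous_src: "continuous_map (top_of \<G>) (top_of \<G>) (src \<G>)"
proof -
  have "continuous_map (top_of \<G>)
      (subtopology (prod_topology (top_of \<G>) (top_of \<G>)) (composable \<G>)) (\<lambda>g. (ginv \<G> g, g))"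
    using continuous_inv
    by (auto simp: continuous_map_in_subtopology composable_iff inv_closed src_inv
        intro!: continuous_map_pairedI simp flip: arrows_def)
  from continuous_map_compose[OF this continuous_comp] show ?thesis
    by (simp add: o_def src_def[abs_def])
qed

lemma continuous_rng: "continuous_map (top_of \<G>) (top_of \<G>) (rng \<G>)"
proof -
  have "continuous_map (top_of \<G>)
      (subtopology (prod_topology (top_of \<G>) (top_of \<G>)) (composable \<G>)) (\<lambda>g. (g, ginv \<G> g))"
    using continuous_inv
    by (auto simp: continuous_map_in_subtopology composable_iff inv_closed rng_inv
        intro!: continuous_map_pairedI simp flip: arrows_def)
  from continuous_map_compose[OF this continuous_comp] show ?thesis
    by (simp add: o_def rng_def[abs_def])
qed

lemma openin_src_vimage: "openin (top_of \<G>) O' \<Longrightarrow> openin (top_of \<G>) {g \<in> arrows \<G>. src \<G> g \<in> O'}"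
  unfolding arrows_def by (rule openin_continuous_map_preimage[OF continuous_src])

lemma openin_rng_vimage: "openin (top_of \<G>) O' \<Longrightarrow> openin (top_of \<G>) {g \<in> arrows \<G>. rng \<G> g \<in> O'}"
  unfolding arrows_def by (rule openin_continuous_map_preimage[OF continuous_rng])

lemma local_homeomorphism_srcE:
  assumes "g \<in> arrows \<G>"
  obtains U where "openin (top_of \<G>) U" "g \<in> U"
    "openin (subtopology (top_of \<G>) (units \<G>)) (src \<G> ` U)"
    "homeomorphic_map (subtopology (top_of \<G>) U)
       (subtopology (subtopology (top_of \<G>) (units \<G>)) (src \<G> ` U)) (src \<G>)"
  using local_homeomorphism_src assms unfolding local_homeomorphism_def arrows_def by blast

text \<open>Near a unit \<open>x\<close>, both \<open>g\<close> and \<open>src g\<close> lie in a neighbourhood of \<open>x\<close> on which the source map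
  is injective; having the same source, they coincide.\<close>

lemma openin_units: "openin (top_of \<G>) (units \<G>)"
proof (subst openin_subopen, intro ballI)
  fix x assume x: "x \<in> units \<G>"
  obtain U where U: "openin (top_of \<G>) U" "x \<in> U"
    "homeomorphic_map (subtopology (top_of \<G>) U)
       (subtopology (subtopology (top_of \<G>) (units \<G>)) (src \<G> ` U)) (src \<G>)"
    using local_homeomorphism_srcE[OF unitsD(1)[OF x]] by metis
  have UG: "U \<subseteq> arrows \<G>"
    using U(1) openin_subset unfolding arrows_def by blast
  have inj: "inj_on (src \<G>) U"
    using homeomorphic_imp_injective_map[OF U(3)] UG
    by (simp add: arrows_def Int_absorb1)
  let ?T = "{g \<in> arrows \<G>. src \<G> g \<in> U} \<inter> U"
  have "openin (top_of \<G>) ?T"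
    using U(1) by (intro openin_Int openin_src_vimage)
  moreover have "x \<in> ?T"
    using U(2) unitsD[OF x] by simp
  moreover have "?T \<subseteq> units \<G>"
  proof
    fix g assume "g \<in> ?T"
    then have "src \<G> g = g"
      using inj src_src[of g] by (auto simp: inj_on_def)
    with \<open>g \<in> ?T\<close> show "g \<in> units \<G>"
      using src_units[of g] by simp
  qed
  ultimately show "\<exists>T. openin (top_of \<G>) T \<and> x \<in> T \<and> T \<subseteq> units \<G>"
    by blast
qed

text \<open>Near each arrow the source is a homeomorphism onto an open subset of the unit space; by
  \<open>openin_units\<close>, open sets of the unit space are open among all arrows.\<close>

lemma openin_src_image:
  assumes "openin (top_of \<G>) O'"
  shows "openin (top_of \<G>) (src \<G> ` O')"
proof (subst openin_subopen, intro ballI)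
  fix y assume "y \<in> src \<G> ` O'"
  then obtain g where g: "g \<in> O'" "y = src \<G> g"
    by blast
  then have "g \<in> arrows \<G>"
    using assms openin_subset unfolding arrows_def by blast
  then obtain U where U: "openin (top_of \<G>) U" "g \<in> U"
    "openin (subtopology (top_of \<G>) (units \<G>)) (src \<G> ` U)"
    "homeomorphic_map (subtopology (top_of \<G>) U)
       (subtopology (subtopology (top_of \<G>) (units \<G>)) (src \<G> ` U)) (src \<G>)"
    by (rule local_homeomorphism_srcE)
  have "openin (subtopology (top_of \<G>) U) (O' \<inter> U)"
    using assms by (rule openin_subtopology_Int)
  then have "openin (subtopology (subtopology (top_of \<G>) (units \<G>)) (src \<G> ` U)) (src \<G> ` (O' \<inter> U))"
    using homeomorphic_imp_open_map[OF U(4)] unfolding open_map_def by blast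
  then have "openin (top_of \<G>) (src \<G> ` (O' \<inter> U))"
    using U(3) openin_units by (simp add: openin_open_subtopology)
  then show "\<exists>T. openin (top_of \<G>) T \<and> y \<in> T \<and> T \<subseteq> src \<G> ` O'"
    using g U(2) by blast
qed

lemma compact_sliceD:
  assumes "compact_slice \<G> S"
  shows "openin (top_of \<G>) S" "S \<subseteq> arrows \<G>" "inj_on (src \<G>) S" "inj_on (rng \<G>) S"
    "compactin (top_of \<G>) S" "Hausdorff_space (subtopology (top_of \<G>) S)"
  using assms openin_subset
  by (auto simp: compact_slice_def slice_def compact_Hausdorffin_def arrows_def)

section \<open>Compact open neighbourhoods of units\<close>

text \<open>Phrased through \<open>compact_slice\<close> so that the lemmas on slices apply;
  \<open>unit_nbhd_iff\<close> identifies these sets with the index sets of the intersection in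
  \<open>res\<close>.\<close>

definition unit_nbhd :: "'a \<Rightarrow> 'a set \<Rightarrow> bool" where
  "unit_nbhd x U \<longleftrightarrow> compact_slice \<G> U \<and> U \<subseteq> units \<G> \<and> x \<in> U"

text \<open>Source and range are the identity on units, so a set of units satisfies the injectivity
  conditions of a slice.\<close>

lemma unit_nbhd_iff:
  "unit_nbhd x U \<longleftrightarrow>
    openin (top_of \<G>) U \<and> compact_Hausdorffin (top_of \<G>) U \<and> U \<subseteq> units \<G> \<and> x \<in> U"
proof -
  have "inj_on (src \<G>) U \<and> inj_on (rng \<G>) U" if "U \<subseteq> units \<G>"
    unfolding inj_on_def using that unitsD(2,3) by (metis subsetD)
  then show ?thesis
    by (auto simp: unit_nbhd_def compact_slice_def slice_def)
qed

text \<open>The source map is open and continuous, and its values lie in the Hausdorff unit space.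
  These neighbourhoods are used to cut one slice down to another.\<close>

lemma unit_nbhd_src:
  assumes "compact_slice \<G> S" "g \<in> S"
  shows "unit_nbhd (src \<G> g) (src \<G> ` S)"
proof -
  note S = compact_sliceD[OF assms(1)]
  have sub: "src \<G> ` S \<subseteq> units \<G>"
    using S(2) src_units by blast
  have "Hausdorff_space (subtopology (top_of \<G>) (src \<G> ` S))"
    using Hausdorff_space_subtopology[OF Hausdorff_units, of "src \<G> ` S"] sub
    by (simp add: subtopology_subtopology Int_absorb1)
  then show ?thesis
    using S sub assms(2) image_compactin[OF S(5) continuous_src]
    by (simp add: unit_nbhd_iff compact_Hausdorffin_def openin_src_image)
qed

end

context ample_groupoid
begin

lemma compact_slice_nbhd:
  assumes "openin (top_of \<G>) O'" "g \<in> O'"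
  obtains S where "compact_slice \<G> S" "g \<in> S" "S \<subseteq> O'"
proof -
  have "(arbitrary union_of compact_slice \<G>) O'"
    using assms(1) compact_slices_basis by simp
  then obtain \<U> where "\<U> \<subseteq> Collect (compact_slice \<G>)" "\<Union>\<U> = O'"
    unfolding union_of_def by blast
  with assms(2) that show ?thesis
    by blast
qed

lemma compact_slice_exists:
  assumes "g \<in> arrows \<G>"
  obtains S where "compact_slice \<G> S" "g \<in> S"
  using compact_slice_nbhd[of "arrows \<G>" g] assms unfolding arrows_def by auto

lemma unit_nbhd_subset:
  assumes "openin (top_of \<G>) O'" "x \<in> O'" "x \<in> units \<G>"
  obtains U where "unit_nbhd x U" "U \<subseteq> O'"
  using compact_slice_nbhd[of "O' \<inter> units \<G>" x] assms openin_units
  unfolding unit_nbhd_def by (metis IntI le_inf_iff openin_Int)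

lemma unit_nbhd_disjoint:
  assumes "compact_slice \<G> S" "x \<in> units \<G>" "x \<notin> src \<G> ` S"
  obtains U where "unit_nbhd x U" "U \<inter> src \<G> ` S = {}"
proof -
  note S = compact_sliceD[OF assms(1)]
  have "src \<G> ` S \<subseteq> units \<G>"
    using S(2) src_units by blast
  then have "compactin (subtopology (top_of \<G>) (units \<G>)) (src \<G> ` S)"
    using image_compactin[OF S(5) continuous_src] by (simp add: compactin_subtopology)
  then have "closedin (subtopology (top_of \<G>) (units \<G>)) (src \<G> ` S)"
    using Hausdorff_units by (rule compactin_imp_closedin[rotated])
  then have "openin (subtopology (top_of \<G>) (units \<G>)) (units \<G> - src \<G> ` S)"
    using units_subset by (simp add: closedin_def arrows_def Int_absorb1)
  then have "openin (top_of \<G>) (units \<G> - src \<G> ` S)"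
    using openin_units by (simp add: openin_open_subtopology)
  then obtain U where "unit_nbhd x U" "U \<subseteq> units \<G> - src \<G> ` S"
    using assms by (elim unit_nbhd_subset) auto
  with that show ?thesis
    by blast
qed

lemma unit_nbhd_separate:
  assumes "x \<in> units \<G>" "y \<in> units \<G>" "x \<noteq> y"
  obtains U where "unit_nbhd x U" "y \<notin> U"
proof -
  have "topspace (subtopology (top_of \<G>) (units \<G>)) = units \<G>"
    using units_subset by (simp add: arrows_def Int_absorb1)
  then obtain A B where AB: "openin (subtopology (top_of \<G>) (units \<G>)) A" "x \<in> A" "y \<in> B" "disjnt A B"
    using Hausdorff_units assms unfolding Hausdorff_space_def by metis
  then have "openin (top_of \<G>) A"
    using openin_units by (simp add: openin_open_subtopology)
  then obtain U where "unit_nbhd x U" "U \<subseteq> A"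
    using AB assms by (elim unit_nbhd_subset) auto
  with that AB show ?thesis
    by (auto simp: disjnt_def)
qed

section \<open>Spanning of the algebra by characteristic functions\<close>

text \<open>\<open>S\<close> itself is the required open Hausdorff set: there the function is
  constantly 1, and a closure taken inside the compact space \<open>S\<close> is compact.\<close>

lemma chi_generator:
  assumes "compact_slice \<G> S"
  shows "(chi S :: 'a \<Rightarrow> 'k::{comm_ring, comm_monoid_mult}) \<in> algebra_generators \<G>"
proof -
  note S = compact_sliceD[OF assms]
  let ?X = "subtopology (top_of \<G>) S"
  have top: "topspace ?X = S"
    using S(2) by (simp add: arrows_def Int_absorb1)
  have "continuous_map ?X (discrete_topology UNIV) (chi S :: 'a \<Rightarrow> 'k)"
    by (rule continuous_map_eq[of _ _ "\<lambda>_. 1"]) (simp_all add: chi_def)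
  moreover have "compactin ?X (?X closure_of {g \<in> S. (chi S g :: 'k) \<noteq> 0})"
  proof (rule closed_compactin[of _ S])
    show "compactin ?X S"
      using S(5) by (simp add: compactin_subtopology)
    show "?X closure_of {g \<in> S. (chi S g :: 'k) \<noteq> 0} \<subseteq> S"
      using closure_of_subset_topspace[of ?X] top by simp
  qed simp
  ultimately show ?thesis
    unfolding algebra_generators_def using S by (intro CollectI exI[of _ S]) (simp add: chi_def)
qed

lemma acarrier_zero:
  "(\<lambda>_. 0) \<in> acarrier (groupoid_algebra \<G> :: ('k::{comm_ring, comm_monoid_mult}, 'a \<Rightarrow> 'k) kalgebra)"
  by (auto simp: groupoid_algebra_def intro!: exI[of _ "0::nat"])

lemma acarrier_add_generator:
  fixes a f :: "'a \<Rightarrow> 'k::{comm_ring, comm_monoid_mult}"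
  assumes "a \<in> acarrier (groupoid_algebra \<G>)" "f \<in> algebra_generators \<G>"
  shows "(\<lambda>g. a g + c * f g) \<in> acarrier (groupoid_algebra \<G>)"
proof -
  obtain n c' h where a: "a = (\<lambda>g. \<Sum>i<(n::nat). c' i * h i g)" "\<forall>i<n. h i \<in> algebra_generators \<G>"
    using assms(1) by (auto simp: groupoid_algebra_def)
  have "(\<lambda>g. a g + c * f g) = (\<lambda>g. \<Sum>i<Suc n. (c'(n := c)) i * (h(n := f)) i g)"
    by (auto simp: a(1))
  moreover have "\<forall>i<Suc n. (h(n := f)) i \<in> algebra_generators \<G>"
    using a(2) assms(2) by (simp add: less_Suc_eq)
  ultimately show ?thesis
    unfolding groupoid_algebra_def kalgebra.simps by blast
qed

lemma acarrier_scale_chi: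
  fixes c :: "'k::{comm_ring, comm_monoid_mult}"
  assumes "compact_slice \<G> S"
  shows "(\<lambda>g. c * chi S g) \<in> acarrier (groupoid_algebra \<G>)"
  using acarrier_add_generator[OF acarrier_zero chi_generator[OF assms], of c] by simp

lemma acarrier_chi:
  assumes "compact_slice \<G> S"
  shows "(chi S :: 'a \<Rightarrow> 'k::{comm_ring, comm_monoid_mult}) \<in> acarrier (groupoid_algebra \<G>)"
  using acarrier_scale_chi[OF assms, of "1::'k"] by simp

lemma acarrier_add:
  fixes a b :: "'a \<Rightarrow> 'k::{comm_ring, comm_monoid_mult}"
  assumes "a \<in> acarrier (groupoid_algebra \<G>)" "b \<in> acarrier (groupoid_algebra \<G>)"
  shows "(\<lambda>g. a g + b g) \<in> acarrier (groupoid_algebra \<G>)"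
proof -
  obtain n c h where b: "b = (\<lambda>g. \<Sum>i<(n::nat). c i * h i g)" "\<forall>i<n. h i \<in> algebra_generators \<G>"
    using assms(2) by (auto simp: groupoid_algebra_def)
  have "(\<lambda>g. a g + (\<Sum>i<m. c i * h i g)) \<in> acarrier (groupoid_algebra \<G>)" if "m \<le> n" for m
    using that
  proof (induction m)
    case 0
    show ?case
      using assms(1) by simp
  next
    case (Suc m)
    then show ?case
      using acarrier_add_generator[of "\<lambda>g. a g + (\<Sum>i<m. c i * h i g)" "h m" "c m"] b(2)
      by (simp add: add.assoc)
  qed
  from this[OF order_refl] show ?thesis
    by (simp add: b(1))
qed

text \<open>The arrow space need not be Hausdorff, and compact sets need not be closed in it. Inside
  the Hausdorff set \<open>W\<close> both \<open>S\<close> and \<open>C\<close> are clopen, so the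
  difference is open, and compact as a closed subset of \<open>S\<close>.\<close>

lemma compact_slice_Diff:
  assumes W: "Hausdorff_space (subtopology (top_of \<G>) W)" "openin (top_of \<G>) W"
    and S: "compact_slice \<G> S" "S \<subseteq> W"
    and C: "openin (top_of \<G>) C" "compactin (top_of \<G>) C" "C \<subseteq> W"
  shows "compact_slice \<G> (S - C)"
proof -
  note S' = compact_sliceD[OF S(1)]
  let ?X = "subtopology (top_of \<G>) W"
  have closed: "closedin ?X D" if "compactin (top_of \<G>) D" "D \<subseteq> W" for D
    using W(1) that by (simp add: compactin_imp_closedin compactin_subtopology)
  have open': "openin ?X D" if "openin (top_of \<G>) D" "D \<subseteq> W" for D
    using that W(2) by (simp add: openin_open_subtopology)
  have "openin ?X (S - C)"
    using S S' C by (intro openin_diff open' closed)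
  then have 1: "openin (top_of \<G>) (S - C)"
    using W(2) by (simp add: openin_open_subtopology)
  have "closedin ?X (S - C)"
    using S S' C by (intro closedin_diff open' closed)
  moreover have "compactin ?X S"
    using S S' by (simp add: compactin_subtopology)
  ultimately have "compactin ?X (S - C)"
    using closed_compactin[of ?X S "S - C"] by blast
  then have 2: "compactin (top_of \<G>) (S - C)"
    by (simp add: compactin_subtopology)
  have "Hausdorff_space (subtopology (top_of \<G>) (S - C))"
    using Hausdorff_space_subtopology[OF S'(6), of "S - C"]
    by (simp add: subtopology_subtopology Int_absorb1)
  with 1 2 show ?thesis
    using S' by (simp add: compact_slice_def slice_def compact_Hausdorffin_def inj_on_diff)
qed

text \<open>A compact open subset of the Hausdorff space \<open>W\<close> is clopen in it, so removing the other slices of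
  the cover from \<open>S\<close> leaves a compact slice.\<close>

lemma slicewise_constant_induct:
  fixes f :: "'a \<Rightarrow> 'k::{comm_ring, comm_monoid_mult}"
  assumes W: "Hausdorff_space (subtopology (top_of \<G>) W)" "openin (top_of \<G>) W"
    and fin: "finite \<S>"
    and const: "\<And>S. S \<in> \<S> \<Longrightarrow> compact_slice \<G> S \<and> S \<subseteq> W \<and> (\<exists>c. \<forall>g\<in>S. f g = c)"
    and supp: "\<And>g. g \<notin> \<Union>\<S> \<Longrightarrow> f g = 0"
    and zero: "P (\<lambda>_. 0)"
    and add: "\<And>a b. P a \<Longrightarrow> P b \<Longrightarrow> P (\<lambda>g. a g + b g)"
    and chi: "\<And>S c. compact_slice \<G> S \<Longrightarrow> P (\<lambda>g. c * chi S g)"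
  shows "P f"
  using fin const supp
proof (induction \<S> arbitrary: f)
  case empty
  then have "f = (\<lambda>_. 0)"
    by auto
  with zero show ?case
    by simp
next
  case (insert S \<S>)
  let ?C = "\<Union>\<S>"
  obtain c where c: "\<And>g. g \<in> S \<Longrightarrow> f g = c"
    using insert.prems(1)[of S] by auto
  have "P (\<lambda>g. if g \<in> ?C then f g else 0)"
  proof (rule insert.IH)
    fix T assume T: "T \<in> \<S>"
    then have "\<And>g. g \<in> T \<Longrightarrow> g \<in> ?C"
      by blast
    with T insert.prems(1)[of T] show
      "compact_slice \<G> T \<and> T \<subseteq> W \<and> (\<exists>c. \<forall>g\<in>T. (if g \<in> ?C then f g else 0) = c)"
      by auto
  qed auto
  moreover have "P (\<lambda>g. c * chi (S - ?C) g)"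
  proof (intro chi compact_slice_Diff[OF W])
    show "openin (top_of \<G>) ?C" "compactin (top_of \<G>) ?C" "?C \<subseteq> W"
      using insert.prems(1) insert.hyps(1) compact_sliceD
      by (auto intro!: compactin_Union)
  qed (use insert.prems(1)[of S] in auto)
  ultimately have "P (\<lambda>g. (if g \<in> ?C then f g else 0) + c * chi (S - ?C) g)"
    by (rule add)
  moreover have "(\<lambda>g. (if g \<in> ?C then f g else 0) + c * chi (S - ?C) g) = f"
    using c insert.prems(2) by (auto simp: chi_def fun_eq_iff)
  ultimately show ?case
    by simp
qed

text \<open>A generator is locally constant on its Hausdorff set, so finitely many compact slices on
  which it is constant cover its support; \<open>slicewise_constant_induct\<close> then
  applies.\<close>

lemma acarrier_induct [consumes 1, case_names zero add chi]:
  fixes a :: "'a \<Rightarrow> 'k::{comm_ring, comm_monoid_mult}"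
  assumes "a \<in> acarrier (groupoid_algebra \<G>)"
    and zero: "P (\<lambda>_. 0)"
    and add: "\<And>a b. a \<in> acarrier (groupoid_algebra \<G>) \<Longrightarrow> b \<in> acarrier (groupoid_algebra \<G>) \<Longrightarrow>
      P a \<Longrightarrow> P b \<Longrightarrow> P (\<lambda>g. a g + b g)"
    and chi: "\<And>S c. compact_slice \<G> S \<Longrightarrow> P (\<lambda>g. c * chi S g)"
  shows "P a"
proof -
  \<comment> \<open>The case \<open>add\<close> offers membership of both summands in the algebra,
    which additivity of the action in its first argument requires; \<open>Q\<close> carries this
    membership along.\<close>
  define Q where "Q a \<longleftrightarrow> a \<in> acarrier (groupoid_algebra \<G>) \<and> P a" for a
  have Q_zero: "Q (\<lambda>_. 0)"
    using zero acarrier_zero by (simp add: Q_def)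
  have Q_add: "Q (\<lambda>g. a g + b g)" if "Q a" "Q b" for a b
    using that unfolding Q_def by (intro conjI acarrier_add add) auto
  have Q_chi: "Q (\<lambda>g. c * chi S g)" if "compact_slice \<G> S" for S c
    using that acarrier_scale_chi chi by (simp add: Q_def)
  have Q_generator: "Q (\<lambda>g. c * f g)" if f: "f \<in> algebra_generators \<G>" for c :: 'k and f
  proof -
    obtain W where W: "openin (top_of \<G>) W" "Hausdorff_space (subtopology (top_of \<G>) W)"
      and supp: "\<forall>g. g \<notin> W \<longrightarrow> f g = 0"
      and cont: "continuous_map (subtopology (top_of \<G>) W) (discrete_topology UNIV) f"
      and comp: "compactin (subtopology (top_of \<G>) W)
        (subtopology (top_of \<G>) W closure_of {g \<in> W. f g \<noteq> 0})"
      using f unfolding algebra_generators_def by (elim CollectE exE conjE) blast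
    let ?K = "subtopology (top_of \<G>) W closure_of {g \<in> W. f g \<noteq> 0}"
    let ?\<S> = "{S. compact_slice \<G> S \<and> S \<subseteq> W \<and> (\<exists>c. \<forall>g\<in>S. f g = c)}"
    have WG: "W \<subseteq> topspace (top_of \<G>)"
      using W(1) by (rule openin_subset)
    have "compactin (top_of \<G>) ?K" "?K \<subseteq> W"
      using comp by (auto simp: compactin_subtopology)
    moreover have "W \<subseteq> \<Union>?\<S>"
    proof
      fix g assume g: "g \<in> W"
      \<comment> \<open>The scalars are discrete, so this level set of \<open>f\<close> is open and
        contains a compact slice around \<open>g\<close>.\<close>
      let ?O = "{h \<in> topspace (subtopology (top_of \<G>) W). f h \<in> {f g}}"
      have "openin (subtopology (top_of \<G>) W) ?O"
        by (rule openin_continuous_map_preimage[OF cont]) simp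
      then have "openin (top_of \<G>) ?O"
        using W(1) by (simp add: openin_open_subtopology)
      then obtain S where "compact_slice \<G> S" "g \<in> S" "S \<subseteq> ?O"
        using g WG by (elim compact_slice_nbhd[of _ g]) auto
      then show "g \<in> \<Union>?\<S>"
        by auto
    qed
    moreover have "openin (top_of \<G>) S" if "S \<in> ?\<S>" for S
      using that compact_sliceD(1) by blast
    ultimately obtain \<F> where \<F>: "finite \<F>" "\<F> \<subseteq> ?\<S>" "?K \<subseteq> \<Union>\<F>"
      using compactinD[of "top_of \<G>" ?K ?\<S>] by (meson subset_trans)
    have "{g \<in> W. f g \<noteq> 0} \<subseteq> ?K"
      using WG by (intro closure_of_subset) auto
    with \<F>(3) supp have "f g = 0" if "g \<notin> \<Union>\<F>" for g
      using that by blast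
    then have supp': "c * f g = 0" if "g \<notin> \<Union>\<F>" for g
      using that by simp
    have const: "compact_slice \<G> S \<and> S \<subseteq> W \<and> (\<exists>d. \<forall>g\<in>S. c * f g = d)" if "S \<in> \<F>" for S
      using that \<F>(2) by auto
    show ?thesis
      using W(2,1) \<F>(1) const supp' Q_zero Q_add Q_chi by (rule slicewise_constant_induct)
  qed
  obtain n c f where a: "a = (\<lambda>g. \<Sum>i<(n::nat). c i * f i g)" "\<forall>i<n. f i \<in> algebra_generators \<G>"
    using assms(1) by (auto simp: groupoid_algebra_def)
  have "Q (\<lambda>g. \<Sum>i<m. c i * f i g)" if "m \<le> n" for m
    using that
  proof (induction m)
    case 0
    show ?case
      using Q_zero by simp
  next
    case (Suc m)
    then show ?case
      using Q_add[of "\<lambda>g. \<Sum>i<m. c i * f i g" "\<lambda>g. c m * f m g"] Q_generator[of "f m" "c m"] a(2)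
      by simp
  qed
  from this[OF order_refl] show ?thesis
    by (simp add: a(1) Q_def)
qed

end

section \<open>The action of arrows on restrictions\<close>

locale ample_module = ample_groupoid \<G> + algebra_module "groupoid_algebra \<G>" smul act V
  for \<G> :: "'g top_groupoid"
    and smul :: "'k::{comm_ring, comm_monoid_mult} \<Rightarrow> 'v::ab_group_add \<Rightarrow> 'v"
    and act :: "('g \<Rightarrow> 'k) \<Rightarrow> 'v \<Rightarrow> 'v"
    and V :: "'v set"
begin

abbreviation Res :: "'g \<Rightarrow> 'v set" where
  "Res \<equiv> res \<G> act V"

abbreviation arrow_act :: "'g \<Rightarrow> 'v \<Rightarrow> 'v" where
  "arrow_act \<equiv> isotropy_act \<G> act"

lemma act_chi_mem: "compact_slice \<G> S \<Longrightarrow> v \<in> V \<Longrightarrow> act (chi S) v \<in> V"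
  by (intro act_closed acarrier_chi)

lemma act_chi_add:
  "compact_slice \<G> S \<Longrightarrow> v \<in> V \<Longrightarrow> w \<in> V \<Longrightarrow> act (chi S) (v + w) = act (chi S) v + act (chi S) w"
  by (intro act_add_right acarrier_chi)

lemma act_chi_smul:
  "compact_slice \<G> S \<Longrightarrow> v \<in> V \<Longrightarrow> act (chi S) (smul c v) = smul c (act (chi S) v)"
  by (intro act_scale_right acarrier_chi)

text \<open>The right-hand side is the action of a convolution product, so
  \<open>set_comp S T\<close> does not have to be recognized as a compact slice.\<close>

lemma act_chi_chi:
  assumes "compact_slice \<G> S" "compact_slice \<G> T" "v \<in> V"
  shows "act (chi S) (act (chi T) v) = act (chi (set_comp S T)) v"
proof -
  have "act (amult (groupoid_algebra \<G>) (chi S) (chi T)) v = act (chi S) (act (chi T) v)"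
    using assms by (intro act_mult acarrier_chi)
  then show ?thesis
    using assms by (simp add: amult_chi compact_sliceD)
qed

lemma act_zero_fun: "v \<in> V \<Longrightarrow> act (\<lambda>_. 0) v = 0"
  using zero_act acarrier_zero by (simp add: zero_fun_def)

lemma act_chi_empty:
  assumes "v \<in> V"
  shows "act (chi {}) v = 0"
proof -
  have "chi {} = (\<lambda>_::'g. 0::'k)"
    by (simp add: chi_def)
  then show ?thesis
    using act_zero_fun[OF assms] by simp
qed

text \<open>As \<open>U U = U\<close> for a set of units, \<open>chi U\<close> acts as an
  idempotent, and the image of an idempotent is its set of fixed vectors.\<close>

lemma Res_iff:
  assumes "x \<in> units \<G>"
  shows "v \<in> Res x \<longleftrightarrow> v \<in> V \<and> (\<forall>U. unit_nbhd x U \<longrightarrow> act (chi U) v = v)"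
proof -
  have res_eq: "Res x = (\<Inter>U \<in> {U. unit_nbhd x U}. act (chi U) ` V)"
    unfolding res_def unit_nbhd_iff by simp
  have fix_iff: "v \<in> act (chi U) ` V \<longleftrightarrow> v \<in> V \<and> act (chi U) v = v" if U: "unit_nbhd x U" for U
  proof -
    have slice: "compact_slice \<G> U" and "U \<subseteq> units \<G>"
      using U by (auto simp: unit_nbhd_def)
    then have "set_comp U U = U"
      using unitsD(1,2) by (subst set_comp_units_right) auto
    then have "act (chi U) (act (chi U) w) = act (chi U) w" if "w \<in> V" for w
      using that slice by (simp add: act_chi_chi)
    then show ?thesis
      using slice act_chi_mem by (auto simp: image_iff) metis
  qed
  \<comment> \<open>One neighbourhood must exist to give \<open>v \<in> V\<close>, since an
    intersection over the empty family would be everything.\<close>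
  obtain U where "unit_nbhd x U"
    using unit_nbhd_subset[OF openin_units assms assms] by blast
  then show ?thesis
    unfolding res_eq using fix_iff by blast
qed

lemma Res_mem: "x \<in> units \<G> \<Longrightarrow> v \<in> Res x \<Longrightarrow> v \<in> V"
  by (simp add: Res_iff)

lemma Res_fixed: "x \<in> units \<G> \<Longrightarrow> v \<in> Res x \<Longrightarrow> unit_nbhd x U \<Longrightarrow> act (chi U) v = v"
  by (simp add: Res_iff)

lemma Res_zero: "x \<in> units \<G> \<Longrightarrow> 0 \<in> Res x"
  by (simp add: Res_iff zero_closed act_zero acarrier_chi unit_nbhd_def)

lemma Res_add: "x \<in> units \<G> \<Longrightarrow> v \<in> Res x \<Longrightarrow> w \<in> Res x \<Longrightarrow> v + w \<in> Res x"
  by (simp add: Res_iff add_closed act_chi_add unit_nbhd_def)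

lemma Res_smul: "x \<in> units \<G> \<Longrightarrow> v \<in> Res x \<Longrightarrow> smul c v \<in> Res x"
  by (simp add: Res_iff scale_closed act_chi_smul unit_nbhd_def)

section \<open>Arrows as maps between restrictions\<close>

lemma act_chi_shrink:
  assumes S: "compact_slice \<G> S" and T: "compact_slice \<G> T" "T \<subseteq> S" "g \<in> T"
    and v: "v \<in> Res (src \<G> g)"
  shows "act (chi S) v = act (chi T) v"
proof -
  have g: "src \<G> g \<in> units \<G>"
    using T compact_sliceD(2) src_units by blast
  have U: "unit_nbhd (src \<G> g) (src \<G> ` T)"
    using T by (intro unit_nbhd_src)
  then have slice: "compact_slice \<G> (src \<G> ` T)" and "src \<G> ` T \<subseteq> units \<G>"
    by (auto simp: unit_nbhd_def)
  then have "set_comp S (src \<G> ` T) = {s \<in> S. src \<G> s \<in> src \<G> ` T}"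
    using compact_sliceD(2)[OF S] by (intro set_comp_units_right)
  also have "\<dots> = T"
    using compact_sliceD(3)[OF S] T(2) by (auto simp: inj_on_def)
  finally have "set_comp S (src \<G> ` T) = T" .
  then show ?thesis
    using act_chi_chi[OF S slice Res_mem[OF g v]] Res_fixed[OF g v U] by simp
qed

text \<open>Both slices can be shrunk to a common slice around \<open>g\<close> inside
  \<open>S \<inter> T\<close>.\<close>

lemma act_chi_cong:
  assumes "compact_slice \<G> S" "g \<in> S" "compact_slice \<G> T" "g \<in> T" "v \<in> Res (src \<G> g)"
  shows "act (chi S) v = act (chi T) v"
proof -
  have "openin (top_of \<G>) (S \<inter> T)" "g \<in> S \<inter> T"
    using assms by (auto simp: compact_sliceD)
  then obtain R where R: "compact_slice \<G> R" "g \<in> R" "R \<subseteq> S \<inter> T"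
    by (rule compact_slice_nbhd)
  then show ?thesis
    using act_chi_shrink[OF assms(1) R(1) _ R(2) assms(5)]
      act_chi_shrink[OF assms(3) R(1) _ R(2) assms(5)] by simp
qed

text \<open>By \<open>act_chi_cong\<close> the definite description in \<open>isotropy_act\<close>
  has a unique solution, also for arrows outside the isotropy groups.\<close>

lemma arrow_act_eq:
  assumes "compact_slice \<G> S" "g \<in> S" "v \<in> Res (src \<G> g)"
  shows "arrow_act g v = act (chi S) v"
  unfolding isotropy_act_def using assms act_chi_cong by (intro the_equality) blast+

lemma arrow_act_add:
  assumes "g \<in> arrows \<G>" "v \<in> Res (src \<G> g)" "w \<in> Res (src \<G> g)"
  shows "arrow_act g (v + w) = arrow_act g v + arrow_act g w"
proof -
  obtain S where "compact_slice \<G> S" "g \<in> S"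
    using assms(1) by (rule compact_slice_exists)
  then show ?thesis
    using assms Res_add[OF src_units] Res_mem[OF src_units]
    by (simp add: arrow_act_eq[of S] act_chi_add)
qed

lemma arrow_act_smul:
  assumes "g \<in> arrows \<G>" "v \<in> Res (src \<G> g)"
  shows "arrow_act g (smul c v) = smul c (arrow_act g v)"
proof -
  obtain S where "compact_slice \<G> S" "g \<in> S"
    using assms(1) by (rule compact_slice_exists)
  then show ?thesis
    using assms Res_smul[OF src_units] Res_mem[OF src_units]
    by (simp add: arrow_act_eq[of S] act_chi_smul)
qed

lemma arrow_act_unit:
  assumes "x \<in> units \<G>" "v \<in> Res x"
  shows "arrow_act x v = v"
proof -
  obtain U where U: "unit_nbhd x U"
    using unit_nbhd_subset[OF openin_units assms(1) assms(1)] by blast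
  then have "arrow_act x v = act (chi U) v"
    using assms unitsD(2)[OF assms(1)] by (intro arrow_act_eq) (auto simp: unit_nbhd_def)
  then show ?thesis
    using Res_fixed[OF assms U] by simp
qed

text \<open>Given a neighbourhood \<open>U\<close> of \<open>rng \<G> g\<close>, continuity of the
  range yields a slice \<open>T\<close> around \<open>g\<close> with all ranges in \<open>U\<close>;
  then \<open>U T = T\<close>, so \<open>chi U\<close> fixes the image.\<close>

lemma arrow_act_mem:
  assumes g: "g \<in> arrows \<G>" and v: "v \<in> Res (src \<G> g)"
  shows "arrow_act g v \<in> Res (rng \<G> g)"
proof -
  have vV: "v \<in> V"
    using Res_mem[OF src_units[OF g] v] .
  obtain S where S: "compact_slice \<G> S" "g \<in> S"
    using g by (rule compact_slice_exists)
  have "arrow_act g v \<in> V"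
    using S v vV by (simp add: arrow_act_eq[of S] act_chi_mem)
  moreover have "act (chi U) (arrow_act g v) = arrow_act g v" if U: "unit_nbhd (rng \<G> g) U" for U
  proof -
    have U': "compact_slice \<G> U" "U \<subseteq> units \<G>" "rng \<G> g \<in> U"
      using U by (auto simp: unit_nbhd_def)
    have "openin (top_of \<G>) {h \<in> arrows \<G>. rng \<G> h \<in> U}"
      using U'(1) by (intro openin_rng_vimage compact_sliceD)
    then obtain T where T: "compact_slice \<G> T" "g \<in> T" "T \<subseteq> {h \<in> arrows \<G>. rng \<G> h \<in> U}"
      using g U'(3) by (elim compact_slice_nbhd) auto
    have "set_comp U T = T"
      using T U'(2) by (subst set_comp_units_left) auto
    then show ?thesis
      using act_chi_chi[OF U'(1) T(1) vV] arrow_act_eq[OF T(1,2) v] by simp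
  qed
  ultimately show ?thesis
    using Res_iff[OF rng_units[OF g]] by blast
qed

text \<open>For a slice \<open>R\<close> around \<open>h g\<close> and small slices \<open>S\<close> around \<open>h\<close> and \<open>T\<close> around \<open>g\<close>, the products
  \<open>S T\<close> and \<open>R (src T)\<close> coincide. This makes it unnecessary to know that \<open>S T\<close> is a compact slice.\<close>

lemma arrow_act_comp:
  assumes comp: "(h, g) \<in> composable \<G>" and v: "v \<in> Res (src \<G> g)"
  shows "arrow_act (gcomp \<G> h g) v = arrow_act h (arrow_act g v)"
proof -
  have h: "h \<in> arrows \<G>" and g: "g \<in> arrows \<G>" and hg: "src \<G> h = rng \<G> g"
    using comp by (auto simp: composable_iff)
  have vV: "v \<in> V"
    using Res_mem[OF src_units[OF g] v] .
  obtain R where R: "compact_slice \<G> R" "gcomp \<G> h g \<in> R"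
    using comp_closed[OF comp] by (rule compact_slice_exists)
  let ?P = "prod_topology (top_of \<G>) (top_of \<G>)"
  have "openin (subtopology ?P (composable \<G>))
      {p \<in> topspace (subtopology ?P (composable \<G>)). (case p of (a, b) \<Rightarrow> gcomp \<G> a b) \<in> R}"
    using R(1) by (intro openin_continuous_map_preimage[OF continuous_comp] compact_sliceD)
  then obtain W where W: "openin ?P W"
    "{p \<in> topspace (subtopology ?P (composable \<G>)). (case p of (a, b) \<Rightarrow> gcomp \<G> a b) \<in> R} =
      W \<inter> composable \<G>"
    unfolding openin_subtopology by blast
  have hgW: "(h, g) \<in> W"
  proof -
    have "(h, g) \<in> topspace (subtopology ?P (composable \<G>))"
      using comp g h by (simp add: arrows_def)
    then have "(h, g) \<in> W \<inter> composable \<G>"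
      unfolding W(2)[symmetric] using R(2) by simp
    then show ?thesis
      by simp
  qed
  obtain A B where AB: "openin (top_of \<G>) A" "openin (top_of \<G>) B" "h \<in> A" "g \<in> B" "A \<times> B \<subseteq> W"
    using W(1)[unfolded openin_prod_topology_alt, rule_format, OF hgW] by metis
  have AB_R: "gcomp \<G> a b \<in> R" if "a \<in> A" "b \<in> B" "(a, b) \<in> composable \<G>" for a b
  proof -
    have "(a, b) \<in> W \<inter> composable \<G>"
      using that AB(5) by blast
    then show ?thesis
      unfolding W(2)[symmetric] by simp
  qed
  obtain S where S: "compact_slice \<G> S" "h \<in> S" "S \<subseteq> A"
    using AB by (elim compact_slice_nbhd)
  have "openin (top_of \<G>) (B \<inter> {b \<in> arrows \<G>. rng \<G> b \<in> src \<G> ` S})"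
    using AB compact_sliceD(1)[OF S(1)] by (intro openin_Int openin_rng_vimage openin_src_image)
  moreover have "g \<in> B \<inter> {b \<in> arrows \<G>. rng \<G> b \<in> src \<G> ` S}"
    using AB(4) g S(2) hg by (simp add: image_iff) metis
  ultimately obtain T where T: "compact_slice \<G> T" "g \<in> T" "T \<subseteq> B \<inter> {b \<in> arrows \<G>. rng \<G> b \<in> src \<G> ` S}"
    by (rule compact_slice_nbhd)
  have U: "unit_nbhd (src \<G> g) (src \<G> ` T)"
    using T by (intro unit_nbhd_src)
  then have slice: "compact_slice \<G> (src \<G> ` T)" and sub: "src \<G> ` T \<subseteq> units \<G>"
    by (auto simp: unit_nbhd_def)
  have "set_comp S T = {r \<in> R. src \<G> r \<in> src \<G> ` T}"
  proof (intro equalityI subsetI)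
    fix r assume "r \<in> set_comp S T"
    then obtain s t where st: "r = gcomp \<G> s t" "s \<in> S" "t \<in> T" "(s, t) \<in> composable \<G>"
      unfolding set_comp_def by blast
    then show "r \<in> {r \<in> R. src \<G> r \<in> src \<G> ` T}"
      using AB_R[of s t] S(3) T(3) src_comp[of s t] by auto
  next
    fix r assume "r \<in> {r \<in> R. src \<G> r \<in> src \<G> ` T}"
    then obtain t where r: "r \<in> R" "src \<G> r = src \<G> t" "t \<in> T"
      by blast
    then obtain s where s: "s \<in> S" "src \<G> s = rng \<G> t" "t \<in> arrows \<G>"
      using T(3) by fastforce
    then have c: "(s, t) \<in> composable \<G>"
      using compact_sliceD(2)[OF S(1)] by (auto simp: composable_iff)
    have "gcomp \<G> s t \<in> R"
      using c s r S(3) T(3) by (intro AB_R) auto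
    moreover have "src \<G> (gcomp \<G> s t) = src \<G> r"
      using c r by (simp add: src_comp)
    ultimately have "r = gcomp \<G> s t"
      using r compact_sliceD(3)[OF R(1)] by (auto simp: inj_on_def)
    then show "r \<in> set_comp S T"
      unfolding set_comp_def using s r c by blast
  qed
  also have "\<dots> = set_comp R (src \<G> ` T)"
    using set_comp_units_right[OF compact_sliceD(2)[OF R(1)] sub] by simp
  finally have eq: "set_comp S T = set_comp R (src \<G> ` T)" .
  have "arrow_act h (arrow_act g v) = act (chi S) (act (chi T) v)"
    using arrow_act_eq[OF S(1,2), of "arrow_act g v"] arrow_act_mem[OF g v] hg
      arrow_act_eq[OF T(1,2) v] by simp
  also have "\<dots> = act (chi R) (act (chi (src \<G> ` T)) v)"
    using act_chi_chi[OF S(1) T(1) vV] act_chi_chi[OF R(1) slice vV] eq by simp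
  also have "\<dots> = act (chi R) v"
    using Res_fixed[OF src_units[OF g] v U] by simp
  also have "\<dots> = arrow_act (gcomp \<G> h g) v"
    using arrow_act_eq[OF R, of v] v src_comp[OF comp] by simp
  finally show ?thesis
    by simp
qed

section \<open>Separation of restrictions at different units\<close>

text \<open>For a neighbourhood \<open>U\<close> of \<open>x\<close> disjoint from the sources of
  \<open>S\<close>, the product \<open>S U\<close> is empty, while \<open>chi U\<close> fixes
  \<open>v\<close>.\<close>

lemma act_chi_Res_zero:
  assumes "compact_slice \<G> S" "x \<in> units \<G>" "x \<notin> src \<G> ` S" "v \<in> Res x"
  shows "act (chi S) v = 0"
proof -
  obtain U where U: "unit_nbhd x U" "U \<inter> src \<G> ` S = {}"
    using assms(1-3) by (rule unit_nbhd_disjoint)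
  have slice: "compact_slice \<G> U" and sub: "U \<subseteq> units \<G>"
    using U(1) by (auto simp: unit_nbhd_def)
  have "set_comp S U = {s \<in> S. src \<G> s \<in> U}"
    using set_comp_units_right[OF compact_sliceD(2)[OF assms(1)] sub] .
  also have "\<dots> = {}"
    using U(2) by auto
  finally have "act (chi S) (act (chi U) v) = act (chi {}) v"
    using act_chi_chi[OF assms(1) slice Res_mem[OF assms(2,4)]] by simp
  then show ?thesis
    using Res_fixed[OF assms(2,4) U(1)] act_chi_empty[OF Res_mem[OF assms(2,4)]] by simp
qed

text \<open>The source is the identity on units, so \<open>act_chi_Res_zero\<close> applies at
  \<open>y\<close> to any neighbourhood \<open>U\<close> of \<open>x\<close> that misses
  \<open>y\<close>.\<close>

lemma Res_separate:
  assumes "x \<in> units \<G>" "y \<in> units \<G>" "x \<noteq> y" "v \<in> Res y"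
  obtains U where "unit_nbhd x U" "act (chi U) v = 0"
proof -
  obtain U where U: "unit_nbhd x U" "y \<notin> U"
    using assms(1-3) by (rule unit_nbhd_separate)
  then have "src \<G> ` U = U"
    using unitsD(2) by (force simp: unit_nbhd_def)
  then show ?thesis
    using that U assms act_chi_Res_zero[of U y v] by (simp add: unit_nbhd_def)
qed

lemma group_representation_Res:
  assumes "x \<in> units \<G>"
  shows "group_representation (isotropy_group \<G> x) smul (Res x) arrow_act"
proof (intro group_representation.intro group_isotropy_group assms)
  show "scalar_module smul (Res x)"
    using Res_zero[OF assms] Res_add[OF assms] Res_smul[OF assms] Res_mem[OF assms]
    by unfold_locales (auto intro: scale_add_right scale_add_left scale_scale scale_one)
  show "group_representation_axioms (isotropy_group \<G> x) smul (Res x) arrow_act"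
  proof
    fix g v assume "g \<in> carrier (isotropy_group \<G> x)" and v: "v \<in> Res x"
    then have g: "g \<in> arrows \<G>" "src \<G> g = x" "rng \<G> g = x"
      by (auto simp: isotropy_group_def)
    show "arrow_act g v \<in> Res x"
      using arrow_act_mem[of g v] g v by simp
    show "arrow_act g (v + w) = arrow_act g v + arrow_act g w" if "w \<in> Res x" for w
      using arrow_act_add[of g v w] g v that by simp
    show "arrow_act g (smul c v) = smul c (arrow_act g v)" for c
      using arrow_act_smul[of g v c] g v by simp
  next
    fix g h v
    assume "g \<in> carrier (isotropy_group \<G> x)" "h \<in> carrier (isotropy_group \<G> x)" "v \<in> Res x"
    then show "arrow_act (g \<otimes>\<^bsub>isotropy_group \<G> x\<^esub> h) v = arrow_act g (arrow_act h v)"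
      by (auto simp: isotropy_group_def composable_iff intro!: arrow_act_comp)
  next
    fix v assume "v \<in> Res x"
    then show "arrow_act \<one>\<^bsub>isotropy_group \<G> x\<^esub> v = v"
      using arrow_act_unit[OF assms] by (simp add: isotropy_group_def)
  qed
qed

section \<open>The submodule generated by a submodule of a restriction\<close>

text \<open>Finite sums of vectors \<open>g n\<close>, built one term at a time to allow induction.
  Scalar coefficients are absent because they can be absorbed into \<open>n\<close> when
  \<open>N\<close> is closed under scalars.\<close>

inductive_set generated_submodule :: "'g \<Rightarrow> 'v set \<Rightarrow> 'v set" for x N where
  zero: "0 \<in> generated_submodule x N"
| step: "g \<in> arrows \<G> \<Longrightarrow> src \<G> g = x \<Longrightarrow> n \<in> N \<Longrightarrow> m \<in> generated_submodule x N \<Longrightarrow>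
    arrow_act g n + m \<in> generated_submodule x N"

lemma generated_submodule_add:
  assumes "m \<in> generated_submodule x N" "m' \<in> generated_submodule x N"
  shows "m + m' \<in> generated_submodule x N"
  using assms by (induction m) (auto simp: add.assoc intro: generated_submodule.step)

context
  fixes x :: 'g and N :: "'v set"
  assumes x: "x \<in> units \<G>"
    and N_sub: "N \<subseteq> Res x"
    and N_zero: "0 \<in> N"
    and N_add: "v \<in> N \<Longrightarrow> w \<in> N \<Longrightarrow> v + w \<in> N"
    and N_smul: "v \<in> N \<Longrightarrow> smul c v \<in> N"
    and N_act: "g \<in> arrows \<G> \<Longrightarrow> src \<G> g = x \<Longrightarrow> rng \<G> g = x \<Longrightarrow> v \<in> N \<Longrightarrow> arrow_act g v \<in> N"
begin

lemma arrow_act_N_mem: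
  assumes "g \<in> arrows \<G>" "src \<G> g = x" "n \<in> N"
  shows "arrow_act g n \<in> Res (rng \<G> g)" "arrow_act g n \<in> V"
proof -
  show "arrow_act g n \<in> Res (rng \<G> g)"
    using arrow_act_mem[of g n] assms N_sub by blast
  then show "arrow_act g n \<in> V"
    using Res_mem[OF rng_units] assms(1) by blast
qed

lemma generated_submodule_subset: "m \<in> generated_submodule x N \<Longrightarrow> m \<in> V"
  by (induction rule: generated_submodule.induct) (auto simp: zero_closed arrow_act_N_mem add_closed)

lemma generated_submodule_smul:
  assumes "m \<in> generated_submodule x N"
  shows "smul c m \<in> generated_submodule x N"
  using assms
proof induction
  case zero
  then show ?case
    by (simp add: scalars.smul_zero generated_submodule.zero)
next
  case (step g n m)
  have "smul c (arrow_act g n + m) = arrow_act g (smul c n) + smul c m"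
    using step N_sub arrow_act_smul[of g n c] arrow_act_N_mem[of g n]
    by (auto simp: scale_add_right generated_submodule_subset)
  then show ?case
    using step by (simp add: generated_submodule.step N_smul)
qed

text \<open>If \<open>S\<close> has an arrow \<open>h\<close> with source \<open>rng \<G> g\<close>,
  then \<open>chi S\<close> sends \<open>g n\<close> to \<open>(h g) n\<close>, again a generator;
  otherwise it sends \<open>g n\<close> to 0.\<close>

lemma generated_submodule_act_chi:
  assumes "m \<in> generated_submodule x N" and S: "compact_slice \<G> S"
  shows "act (chi S) m \<in> generated_submodule x N"
  using assms(1)
proof induction
  case zero
  then show ?case
    using S by (simp add: act_zero acarrier_chi generated_submodule.zero)
next
  case (step g n m)
  note g = arrow_act_N_mem[OF step(1-3)]
  have eq: "act (chi S) (arrow_act g n + m) = act (chi S) (arrow_act g n) + act (chi S) m"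
    using S g(2) generated_submodule_subset[OF step(4)] by (rule act_chi_add)
  show ?case
  proof (cases "rng \<G> g \<in> src \<G> ` S")
    case True
    then obtain h where h: "h \<in> S" "src \<G> h = rng \<G> g"
      by auto
    then have c: "(h, g) \<in> composable \<G>"
      using step compact_sliceD(2)[OF S] by (auto simp: composable_iff)
    have "act (chi S) (arrow_act g n) = arrow_act (gcomp \<G> h g) n"
      using arrow_act_eq[OF S h(1), of "arrow_act g n"] h(2) g arrow_act_comp[OF c, of n] step N_sub
      by auto
    then show ?thesis
      using eq step c by (simp add: generated_submodule.step comp_closed src_comp)
  next
    case False
    then have "act (chi S) (arrow_act g n) = 0"
      using S g step rng_units by (intro act_chi_Res_zero[of S "rng \<G> g"])
    then show ?thesis
      using eq step by simp
  qed
qed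

text \<open>By \<open>acarrier_induct\<close>, closure under the algebra reduces to closure under
  sums, scalars and the functions \<open>chi S\<close>.\<close>

lemma is_submodule_generated_submodule:
  "is_submodule (groupoid_algebra \<G>) smul act V (generated_submodule x N)"
proof -
  have "act a m \<in> generated_submodule x N"
    if "a \<in> acarrier (groupoid_algebra \<G>)" and m: "m \<in> generated_submodule x N" for a m
    using that(1)
  proof (induction rule: acarrier_induct)
    case zero
    show ?case
      using act_zero_fun[OF generated_submodule_subset[OF m]] by (simp add: generated_submodule.zero)
  next
    case (add a b)
    have "act (\<lambda>g. a g + b g) m = act a m + act b m"
      using act_add_left[OF add(1,2) generated_submodule_subset[OF m]] by (simp add: plus_fun_def)
    then show ?case
      using add by (simp add: generated_submodule_add)
  next
    case (chi S c)
    have "act (\<lambda>g. c * chi S g) m = smul c (act (chi S) m)"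
      using act_scale_left[OF acarrier_chi[OF chi] generated_submodule_subset[OF m], of c]
      by (simp add: groupoid_algebra_def)
    then show ?case
      using generated_submodule_smul[OF generated_submodule_act_chi[OF m chi]] by simp
  qed
  then show ?thesis
    unfolding is_submodule_def
    using generated_submodule_subset generated_submodule.zero generated_submodule_add
      generated_submodule_smul by blast
qed

lemma subset_generated_submodule: "N \<subseteq> generated_submodule x N"
proof
  fix n assume n: "n \<in> N"
  have "arrow_act x n + 0 \<in> generated_submodule x N"
    using unitsD[OF x] n by (intro generated_submodule.intros)
  then show "n \<in> generated_submodule x N"
    using arrow_act_unit[OF x, of n] n N_sub by auto
qed

text \<open>A small enough neighbourhood of \<open>x\<close> kills the summands \<open>g n\<close> with \<open>rng g \<noteq> x\<close> and fixes
  those with \<open>g\<close> in the isotropy group.\<close>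

lemma generated_submodule_localize:
  assumes "m \<in> generated_submodule x N"
  shows "\<exists>U. unit_nbhd x U \<and> act (chi U) m \<in> N"
  using assms
proof induction
  case zero
  obtain U where U: "unit_nbhd x U"
    using unit_nbhd_subset[OF openin_units x x] by blast
  then have "act (chi U) 0 = 0"
    by (simp add: act_zero acarrier_chi unit_nbhd_def)
  then show ?case
    using U N_zero by auto
next
  case (step g n m)
  note g = arrow_act_N_mem[OF step(1-3)]
  have mV: "m \<in> V"
    using step(4) by (rule generated_submodule_subset)
  obtain U where U: "unit_nbhd x U" "act (chi U) m \<in> N"
    using step.IH by blast
  obtain U' where U': "unit_nbhd x U'" "act (chi U') (arrow_act g n) \<in> N"
  proof (cases "rng \<G> g = x")
    case True
    then have "act (chi U) (arrow_act g n) = arrow_act g n"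
      using Res_fixed[OF x _ U(1)] g by simp
    then show ?thesis
      using that U N_act[OF step(1,2) True step(3)] by simp
  next
    case False
    then obtain U' where "unit_nbhd x U'" "act (chi U') (arrow_act g n) = 0"
      using Res_separate[OF x rng_units[OF step(1)] _ g(1)] by metis
    then show ?thesis
      using that N_zero by simp
  qed
  have "openin (top_of \<G>) (U \<inter> U')" "x \<in> U \<inter> U'"
    using U U' by (auto simp: unit_nbhd_iff)
  then obtain W where W: "unit_nbhd x W" "W \<subseteq> U \<inter> U'"
    using x by (rule unit_nbhd_subset)
  \<comment> \<open>Shrinking \<open>Y\<close> to \<open>W\<close> changes nothing once
    \<open>chi Y\<close> has moved \<open>v\<close> into \<open>N\<close>, since vectors of the
    restriction are fixed by \<open>chi W\<close>. Thus one neighbourhood serves both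
    summands.\<close>
  have absorb: "act (chi W) v = act (chi Y) v"
    if "unit_nbhd x Y" "W \<subseteq> Y" "v \<in> V" "act (chi Y) v \<in> N" for v Y
  proof -
    have "set_comp W Y = W"
    proof -
      have "set_comp W Y = {s \<in> W. src \<G> s \<in> Y}"
        using W(1) that(1) by (intro set_comp_units_right) (auto simp: unit_nbhd_def compact_sliceD)
      also have "\<dots> = W"
        using W(1) that(2) unitsD(2) by (force simp: unit_nbhd_def)
      finally show ?thesis .
    qed
    then have "act (chi W) v = act (chi W) (act (chi Y) v)"
      using act_chi_chi[of W Y v] W(1) that by (simp add: unit_nbhd_def)
    also have "\<dots> = act (chi Y) v"
      using Res_fixed[OF x _ W(1)] that(4) N_sub by blast
    finally show ?thesis .
  qed
  have "act (chi W) (arrow_act g n + m) = act (chi U') (arrow_act g n) + act (chi U) m"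
    using W absorb[OF U(1) _ mV U(2)] absorb[OF U'(1) _ g(2) U'(2)] act_chi_add[of W "arrow_act g n" m]
      g(2) mV by (simp add: unit_nbhd_def)
  then show ?case
    using W(1) U(2) U'(2) N_add by metis
qed

text \<open>If the generated submodule were \<open>V\<close>, localizing would move every
  \<open>w\<close> of the restriction into \<open>N\<close>; but localizing fixes \<open>w\<close>.
  So a proper \<open>N\<close> generates a proper submodule, which is zero by simplicity and
  contains \<open>N\<close>.\<close>

lemma Res_submodule_trivial:
  assumes simple: "\<And>M. is_submodule (groupoid_algebra \<G>) smul act V M \<Longrightarrow> M = {0} \<or> M = V"
  shows "N = {0} \<or> N = Res x"
proof (rule disjCI)
  assume "N \<noteq> Res x"
  then obtain w where w: "w \<in> Res x" "w \<notin> N"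
    using N_sub by blast
  have "generated_submodule x N \<noteq> V"
  proof
    assume "generated_submodule x N = V"
    then obtain U where "unit_nbhd x U" "act (chi U) w \<in> N"
      using generated_submodule_localize Res_mem[OF x w(1)] by blast
    then show False
      using Res_fixed[OF x w(1)] w(2) by simp
  qed
  then have "generated_submodule x N = {0}"
    using simple[OF is_submodule_generated_submodule] by blast
  then show "N = {0}"
    using subset_generated_submodule N_zero by blast
qed

end

end

section \<open>Simplicity of the restriction\<close>

theorem lemma6p14:
  fixes \<G> :: "'g top_groupoid"
    and smul :: "'k::{comm_ring, comm_monoid_mult} \<Rightarrow> 'v::ab_group_add \<Rightarrow> 'v"
    and act :: "('g \<Rightarrow> 'k) \<Rightarrow> 'v \<Rightarrow> 'v"
    and V :: "'v set"
    and x :: 'g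
  assumes "ample_groupoid \<G>"
    and "x \<in> units \<G>"
    and "simple_module (groupoid_algebra \<G>) smul act V"
  shows "res \<G> act V x = {0} \<or>
    simple_module (group_algebra (isotropy_group \<G> x)) smul (res_act \<G> smul act) (res \<G> act V x)"
proof (cases "res \<G> act V x = {0}")
  case nonzero: False
  interpret ample_groupoid \<G>
    by fact
  interpret algebra_module "groupoid_algebra \<G>" smul act V
    using assms(3) by (simp add: simple_module_def)
  interpret ample_module \<G> smul act V ..
  let ?G = "isotropy_group \<G> x"
  interpret rep: group_representation ?G smul "res \<G> act V x" "isotropy_act \<G> act"
    using assms(2) by (rule group_representation_Res)
  \<comment> \<open>This transfers the module structure of the abstract representation to
    \<open>res_act\<close>.\<close>
  have act_eq: "rep.algebra_act = res_act \<G> smul act"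
    by (intro ext) (simp add: rep.algebra_act_def res_act_def)
  have "N = {0} \<or> N = res \<G> act V x"
    if "is_submodule (group_algebra ?G) smul (res_act \<G> smul act) (res \<G> act V x) N" for N
  proof (rule Res_submodule_trivial[OF assms(2)])
    note N = that[unfolded is_submodule_def, folded act_eq]
    show "N \<subseteq> res \<G> act V x" "0 \<in> N"
      using N by auto
    show "v + w \<in> N" if "v \<in> N" "w \<in> N" for v w
      using N that by blast
    show "smul c v \<in> N" if "v \<in> N" for c v
      using N that by blast
    show "isotropy_act \<G> act g v \<in> N"
      if "g \<in> arrows \<G>" "src \<G> g = x" "rng \<G> g = x" "v \<in> N" for g v
    proof -
      have "g \<in> carrier ?G" "v \<in> res \<G> act V x"
        using that N by (auto simp: isotropy_group_def)
      \<comment> \<open>Acting by the basis element \<open>chi {g}\<close> recovers the action of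
        the single arrow \<open>g\<close>, so a submodule over the group algebra is stable under the
        isotropy group.\<close>
      note chi = rep.algebra_act_chi[OF this]
      then have "rep.algebra_act (chi {g}) v \<in> N"
        using N that(4) by blast
      then show ?thesis
        using chi(2) by simp
    qed
    show "M = {0} \<or> M = V" if "is_submodule (groupoid_algebra \<G>) smul act V M" for M
      using assms(3) that by (simp add: simple_module_def)
  qed
  then show ?thesis
    using rep.algebra_module nonzero by (simp add: simple_module_def act_eq)
qed simp

end
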